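(* Let $n,m,k$ be positive integers, let $X\in\mathbb{C}^{n\times n}$ be Hermitian, let $\Lambda:\mathbb{C}^{n\times n}\to\mathbb{C}^{m\times m}$ be a linear map and $Y\in\mathbb{C}^{m\times m}$. Let $\xi$ be the optimal value of \[ \max_{\rho\in\mathbb{C}^{n\times n}}\ \operatorname{Tr}(X\rho)\quad\text{s.t.}\quad \Lambda(\rho)=Y,\ \operatorname{Tr}(\rho)=1,\ \rho\ge 0,\ \operatorname{rank}(\rho)\le k . \] For a positive integer $N$, let $\mathcal{H}_A=\mathcal{H}_B=\cdots=\mathcal{H}_Z=\mathbb{C}^n\otimes\mathbb{C}^k$ be $N$ copies (parties $A,B,\dots,Z$), let $\widetilde{X}=X\otimes\mathbb{1}_k$, $\widetilde{\Lambda}(\cdot)=\Lambda[\operatorname{Tr}_2(\cdot)]$ with $\operatorname{Tr}_2$ the partial trace over $\mathbb{C}^k$, and let $\xi_N$ be the optimal value of the semidefinite program \[ \max_{\Phi_{AB\cdots Z}}\ \operatorname{Tr}\big[(\widetilde{X}_A\otimes\mathbb{1}_{B\cdots Z})\Phi_{AB\cdots Z}\big]\quad\text{s.t.}\quad \Phi_{AB\cdots Z}\ge0,\ \operatorname{Tr}(\Phi_{AB\cdots Z})=1,\ P_N^+\Phi_{AB\cdots Z}P_N^+=\Phi_{AB\cdots Z}, \] \[ (\widetilde{\Lambda}_A\otimes\mathrm{id}_{B\cdots Z})(\Phi_{AB\cdots Z})=Y\otimes\operatorname{Tr}_A(\Phi_{AB\cdots Z}). \] Then $\xi\le\xi_N$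 for every $N$, and moreover $\xi_{N+1}\le\xi_N$ for all $N$ and $\lim_{N\to+\infty}\xi_N=\xi$.
   Context: $\Phi_{AB\cdots Z}$ ranges over complex Hermitian operators on $\mathcal{H}_A\otimes\cdots\otimes\mathcal{H}_Z=(\mathbb{C}^n\otimes\mathbb{C}^k)^{\otimes N}$. $P_N^+=\frac{1}{N!}\sum_{\sigma\in S_N}V_\sigma$ is the orthogonal projector onto the symmetric subspace of $(\mathbb{C}^n\otimes\mathbb{C}^k)^{\otimes N}$, where $V_\sigma$ permutes the $N$ tensor factors according to $\sigma\in S_N$. A subscript $A$ indicates action on the first party; $\mathrm{id}_{B\cdots Z}$ is the identity map on operators of the remaining $N-1$ parties; $\operatorname{Tr}_A$ is the partial trace over the first party. *)

theory Defs
  imports "HOL-Analysis.Analysis" "HOL-Library.Extended_Real" "HOL-Combinatorics.Permutations"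
    "Jordan_Normal_Form.DL_Rank"
begin

definition mtrace :: "complex mat \<Rightarrow> complex" where
  "mtrace A = (\<Sum>i<dim_row A. A $$ (i,i))"

definition hermitian_mat :: "nat \<Rightarrow> complex mat \<Rightarrow> bool" where
  "hermitian_mat n A \<longleftrightarrow> A \<in> carrier_mat n n \<and> (\<forall>i<n. \<forall>j<n. A $$ (i,j) = cnj (A $$ (j,i)))"

definition psd_mat :: "nat \<Rightarrow> complex mat \<Rightarrow> bool" where
  "psd_mat n A \<longleftrightarrow> A \<in> carrier_mat n n \<and>
     (\<forall>v :: nat \<Rightarrow> complex. let q = (\<Sum>i<n. \<Sum>j<n. cnj (v i) * A $$ (i,j) * v j)
                              in q \<in> \<real> \<and> 0 \<le> Re q)"

definition mat_rank :: "nat \<Rightarrow> complex mat \<Rightarrow> nat" where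
  "mat_rank n A = vec_space.rank n A"

definition linear_map_mat :: "nat \<Rightarrow> nat \<Rightarrow> (complex mat \<Rightarrow> complex mat) \<Rightarrow> bool" where
  "linear_map_mat n m L \<longleftrightarrow>
     (\<forall>A \<in> carrier_mat n n. L A \<in> carrier_mat m m) \<and>
     (\<forall>A \<in> carrier_mat n n. \<forall>B \<in> carrier_mat n n. L (A + B) = L A + L B) \<and>
     (\<forall>A \<in> carrier_mat n n. \<forall>c. L (c \<cdot>\<^sub>m A) = c \<cdot>\<^sub>m L A)"

text \<open>Optimal value xi of the rank-constrained problem (ereal; Sup of the empty set is -infinity).\<close>
definition xi_opt :: "nat \<Rightarrow> nat \<Rightarrow> nat \<Rightarrow> complex mat \<Rightarrow> (complex mat \<Rightarrow> complex mat) \<Rightarrow> complex mat \<Rightarrow> ereal" where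
  "xi_opt n m k X L Y = Sup { ereal (Re (mtrace (X * \<rho>))) | \<rho>.
       \<rho> \<in> carrier_mat n n \<and> L \<rho> = Y \<and> mtrace \<rho> = 1 \<and> psd_mat n \<rho> \<and> mat_rank n \<rho> \<le> k }"

text \<open>A basis index of one party C^n \<otimes> C^k is a pair (i,a), i<n, a<k; a basis index of
  N parties is a list of N such pairs (first entry = party A). Operators are functions
  from pairs of multi-indices to complex numbers.\<close>

definition party_idx :: "nat \<Rightarrow> nat \<Rightarrow> (nat \<times> nat) set" where
  "party_idx n k = {(i,a). i < n \<and> a < k}"

definition multi_idx :: "nat \<Rightarrow> nat \<Rightarrow> nat \<Rightarrow> (nat \<times> nat) list set" where
  "multi_idx n k N = {xs. length xs = N \<and> set xs \<subseteq> party_idx n k}"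

type_synonym op = "(nat \<times> nat) list \<Rightarrow> (nat \<times> nat) list \<Rightarrow> complex"

definition op_trace :: "nat \<Rightarrow> nat \<Rightarrow> nat \<Rightarrow> op \<Rightarrow> complex" where
  "op_trace n k N \<Phi> = (\<Sum>xs\<in>multi_idx n k N. \<Phi> xs xs)"

definition op_psd :: "nat \<Rightarrow> nat \<Rightarrow> nat \<Rightarrow> op \<Rightarrow> bool" where
  "op_psd n k N \<Phi> \<longleftrightarrow>
     (\<forall>v :: (nat \<times> nat) list \<Rightarrow> complex.
        let q = (\<Sum>xs\<in>multi_idx n k N. \<Sum>ys\<in>multi_idx n k N. cnj (v xs) * \<Phi> xs ys * v ys)
        in q \<in> \<real> \<and> 0 \<le> Re q)"

definition op_mult :: "nat \<Rightarrow> nat \<Rightarrow> nat \<Rightarrow> op \<Rightarrow> op \<Rightarrow> op" where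
  "op_mult n k N A B = (\<lambda>xs ys. \<Sum>zs\<in>multi_idx n k N. A xs zs * B zs ys)"

definition perm_op :: "nat \<Rightarrow> (nat \<Rightarrow> nat) \<Rightarrow> op" where
  "perm_op N \<sigma> = (\<lambda>xs ys. if (\<forall>i<N. xs ! i = ys ! (\<sigma> i)) then 1 else 0)"

definition sym_proj :: "nat \<Rightarrow> op" where
  "sym_proj N = (\<lambda>xs ys. (\<Sum>\<sigma>\<in>{\<sigma>. \<sigma> permutes {..<N}}. perm_op N \<sigma> xs ys) / of_nat (fact N))"

text \<open>Tr[(X~_A \<otimes> 1) \<Phi>], with X~ = X \<otimes> 1_k.\<close>
definition obj_N :: "nat \<Rightarrow> nat \<Rightarrow> nat \<Rightarrow> complex mat \<Rightarrow> op \<Rightarrow> complex" where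
  "obj_N n k N X \<Phi> =
     (\<Sum>xs\<in>multi_idx n k (N - 1). \<Sum>i<n. \<Sum>j<n. \<Sum>a<k. X $$ (i,j) * \<Phi> ((j,a) # xs) ((i,a) # xs))"

definition ptrace_A :: "nat \<Rightarrow> nat \<Rightarrow> op \<Rightarrow> op" where
  "ptrace_A n k \<Phi> = (\<lambda>xs ys. \<Sum>x\<in>party_idx n k. \<Phi> (x # xs) (x # ys))"

definition ptrace_2 :: "nat \<Rightarrow> nat \<Rightarrow> ((nat \<times> nat) \<Rightarrow> (nat \<times> nat) \<Rightarrow> complex) \<Rightarrow> complex mat" where
  "ptrace_2 n k M = mat n n (\<lambda>(i,j). \<Sum>a<k. M (i,a) (j,a))"

text \<open>(Lambda~_A \<otimes> id)(\<Phi>) with Lambda~ = Lambda \<circ> Tr_2: entry at row (p, xs), column (q, ys),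
  p,q < m, xs,ys multi-indices of the remaining N-1 parties.\<close>
definition lift_map :: "nat \<Rightarrow> nat \<Rightarrow> (complex mat \<Rightarrow> complex mat) \<Rightarrow> op
                         \<Rightarrow> nat \<Rightarrow> (nat \<times> nat) list \<Rightarrow> nat \<Rightarrow> (nat \<times> nat) list \<Rightarrow> complex" where
  "lift_map n k L \<Phi> p xs q ys = L (ptrace_2 n k (\<lambda>x y. \<Phi> (x # xs) (y # ys))) $$ (p,q)"

definition feasible_N :: "nat \<Rightarrow> nat \<Rightarrow> nat \<Rightarrow> nat \<Rightarrow> (complex mat \<Rightarrow> complex mat) \<Rightarrow> complex mat \<Rightarrow> op \<Rightarrow> bool" where
  "feasible_N n m k N L Y \<Phi> \<longleftrightarrow>
     op_psd n k N \<Phi> \<and> op_trace n k N \<Phi> = 1 \<and>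
     (\<forall>xs\<in>multi_idx n k N. \<forall>ys\<in>multi_idx n k N.
        op_mult n k N (op_mult n k N (sym_proj N) \<Phi>) (sym_proj N) xs ys = \<Phi> xs ys) \<and>
     (\<forall>p<m. \<forall>q<m. \<forall>xs\<in>multi_idx n k (N - 1). \<forall>ys\<in>multi_idx n k (N - 1).
        lift_map n k L \<Phi> p xs q ys = Y $$ (p,q) * ptrace_A n k \<Phi> xs ys)"

text \<open>Optimal value xi_N of the N-party SDP. Only the entries of Phi on
  multi_idx n k N enter any of the constraints or the objective.\<close>
definition xi_N :: "nat \<Rightarrow> nat \<Rightarrow> nat \<Rightarrow> complex mat \<Rightarrow> (complex mat \<Rightarrow> complex mat) \<Rightarrow> complex mat \<Rightarrow> nat \<Rightarrow> ereal" where
  "xi_N n m k X L Y N = Sup { ereal (Re (obj_N n k N X \<Phi>)) | \<Phi>. feasible_N n m k N L Y \<Phi> }"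

end

theory Submission
  imports Defs
begin

text \<open>
  A state of rank at most k on C^n is the reduction of a pure state on C^n \<otimes> C^k, so the
  rank-constrained problem is an optimisation over pure states, and tensor powers of these are
  feasible for every level of the hierarchy.

  For the convergence, feasible states of all levels with objective at least c accumulate, by
  Tychonoff's theorem, at an exchangeable state of infinitely many parties. Among the exchangeable
  states, which form a compact set, take one that maximises first the objective and then the
  Hilbert-Schmidt norm of the one-party marginal \<rho>. A measurement of one party with effects J and
  1 - J decomposes it into two exchangeable states, and by strict convexity of the norm both have
  the one-party marginal \<rho>. Hence two parties are in the product state \<rho> \<otimes> \<rho>; being supported on the
  symmetric subspace, it forces \<rho> to be pure. This replaces the quantum de Finetti theorem and needs
  no integration over pure states.
\<close>

section \<open>Kernels on a finite set\<close>

lemma cnj_of_bool [simp]: "cnj (of_bool P) = of_bool P"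
  by (cases P) simp_all

type_synonym 'a kernel = "'a \<Rightarrow> 'a \<Rightarrow> complex"

definition hs_inner :: "'a set \<Rightarrow> 'a kernel \<Rightarrow> 'a kernel \<Rightarrow> complex" where
  "hs_inner A f g = (\<Sum>(x, y)\<in>A \<times> A. cnj (f x y) * g x y)"

definition outer_prod :: "('a \<Rightarrow> complex) \<Rightarrow> 'a kernel" where
  "outer_prod v x y = v x * cnj (v y)"

definition id_kernel :: "'a kernel" where
  "id_kernel x y = of_bool (x = y)"

lemma hs_inner_cong:
  assumes "\<And>x y. x \<in> A \<Longrightarrow> y \<in> A \<Longrightarrow> f x y = f' x y" "\<And>x y. x \<in> A \<Longrightarrow> y \<in> A \<Longrightarrow> g x y = g' x y"
  shows "hs_inner A f g = hs_inner A f' g'"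
  unfolding hs_inner_def by (rule sum.cong) (auto simp: assms)

lemma hs_inner_sum_right: "hs_inner A f (\<lambda>x y. \<Sum>s\<in>S. g s x y) = (\<Sum>s\<in>S. hs_inner A f (g s))"
  unfolding hs_inner_def by (simp add: sum_distrib_left case_prod_unfold sum.swap[of _ S])

lemma hs_inner_sum_left: "hs_inner A (\<lambda>x y. \<Sum>s\<in>S. f s x y) g = (\<Sum>s\<in>S. hs_inner A (f s) g)"
  unfolding hs_inner_def by (simp add: sum_distrib_right case_prod_unfold sum.swap[of _ S])

lemma hs_inner_add_right: "hs_inner A f (\<lambda>x y. g x y + h x y) = hs_inner A f g + hs_inner A f h"
  by (simp add: hs_inner_def distrib_left case_prod_unfold sum.distrib)

lemma hs_inner_diff_right: "hs_inner A f (\<lambda>x y. g x y - h x y) = hs_inner A f g - hs_inner A f h"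
  by (simp add: hs_inner_def right_diff_distrib case_prod_unfold sum_subtractf)

lemma hs_inner_diff_left: "hs_inner A (\<lambda>x y. f x y - g x y) h = hs_inner A f h - hs_inner A g h"
  by (simp add: hs_inner_def left_diff_distrib case_prod_unfold sum_subtractf)

lemma hs_inner_scale_right: "hs_inner A f (\<lambda>x y. c * g x y) = c * hs_inner A f g"
  by (simp add: hs_inner_def sum_distrib_left case_prod_unfold mult_ac)

lemma hs_inner_scale_left: "hs_inner A (\<lambda>x y. c * f x y) g = cnj c * hs_inner A f g"
  by (simp add: hs_inner_def sum_distrib_left case_prod_unfold mult_ac)

lemma hs_inner_commute:
  "hs_inner A f (\<lambda>x y. hs_inner B g (\<lambda>a b. h a b x y))
    = hs_inner B g (\<lambda>a b. hs_inner A f (\<lambda>x y. h a b x y))"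
  unfolding hs_inner_def sum_distrib_left case_prod_unfold
  by (subst sum.swap) (simp add: mult_ac)

lemma hs_inner_id_kernel:
  assumes "finite A"
  shows "hs_inner A id_kernel f = (\<Sum>x\<in>A. f x x)"
  using assms by (simp add: hs_inner_def id_kernel_def sum.cartesian_product[symmetric] cong: if_cong)

lemma hs_inner_outer_prod_outer_prod:
  "hs_inner A (outer_prod v) (outer_prod w) = complex_of_real ((cmod (\<Sum>x\<in>A. cnj (v x) * w x))\<^sup>2)"
  unfolding complex_norm_square cnj_sum sum_product hs_inner_def outer_prod_def
  by (simp add: sum.cartesian_product mult_ac)

lemma sum_of_bool_pair:
  fixes g :: "'a \<Rightarrow> 'b::semiring_1"
  assumes "finite A" "x \<in> A" "y \<in> A"
  shows "(\<Sum>z\<in>A. (of_bool (z = x) + c * of_bool (z = y)) * g z) = g x + c * g y"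
  using assms by (simp add: distrib_right sum.distrib mult.assoc sum_distrib_left[symmetric])

lemma hs_inner_outer_prod_pair:
  assumes "finite A" "x \<in> A" "y \<in> A"
  shows "hs_inner A (outer_prod (\<lambda>z. of_bool (z = x) + c * of_bool (z = y))) f
    = f x x + c * f x y + cnj c * f y x + cnj c * c * f y y"
proof -
  let ?v = "\<lambda>z. of_bool (z = x) + c * of_bool (z = y)"
  have "hs_inner A (outer_prod ?v) f = (\<Sum>a\<in>A. cnj (?v a) * (\<Sum>b\<in>A. ?v b * f a b))"
    by (simp add: hs_inner_def outer_prod_def sum.cartesian_product[symmetric] sum_distrib_left
        mult.assoc)
  also have "\<dots> = (\<Sum>b\<in>A. ?v b * f x b) + cnj c * (\<Sum>b\<in>A. ?v b * f y b)"
    using sum_of_bool_pair[OF assms, of "cnj c"] by simp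
  finally show ?thesis
    unfolding sum_of_bool_pair[OF assms] by (simp add: algebra_simps)
qed

lemma hs_inner_outer_prod_unit:
  assumes "finite A" "x \<in> A"
  shows "hs_inner A (outer_prod (\<lambda>z. of_bool (z = x))) f = f x x"
  using hs_inner_outer_prod_pair[OF assms(1,2,2), of 0 f] by simp

definition psd_on :: "'a set \<Rightarrow> 'a kernel \<Rightarrow> bool" where
  "psd_on A f \<longleftrightarrow> (\<forall>v. hs_inner A (outer_prod v) f \<in> \<real>\<^sub>\<ge>\<^sub>0)"

lemma hs_inner_outer_prod_eq_sum:
  "hs_inner A (outer_prod v) f = (\<Sum>x\<in>A. \<Sum>y\<in>A. cnj (v x) * f x y * v y)"
  by (simp add: hs_inner_def outer_prod_def sum.cartesian_product mult_ac)

lemma nonneg_Reals_iff_Reals: "z \<in> \<real>\<^sub>\<ge>\<^sub>0 \<longleftrightarrow> z \<in> \<real> \<and> 0 \<le> Re z"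
  by (auto simp: complex_nonneg_Reals_iff complex_is_Real_iff)

lemma nonneg_Reals_sum_I:
  assumes "\<And>s. s \<in> S \<Longrightarrow> z s \<in> \<real>\<^sub>\<ge>\<^sub>0"
  shows "(\<Sum>s\<in>S. z s) \<in> \<real>\<^sub>\<ge>\<^sub>0"
  using assms by (induction S rule: infinite_finite_induct) auto

lemma psd_on_cong:
  assumes "\<And>x y. x \<in> A \<Longrightarrow> y \<in> A \<Longrightarrow> f x y = g x y"
  shows "psd_on A f \<longleftrightarrow> psd_on A g"
proof -
  have "hs_inner A (outer_prod v) f = hs_inner A (outer_prod v) g" for v
    by (rule hs_inner_cong) (simp_all add: assms)
  then show ?thesis by (simp add: psd_on_def)
qed

lemma psd_on_sum:
  assumes "\<And>s. s \<in> S \<Longrightarrow> psd_on A (f s)"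
  shows "psd_on A (\<lambda>x y. \<Sum>s\<in>S. f s x y)"
  unfolding psd_on_def hs_inner_sum_right
  by (intro allI nonneg_Reals_sum_I) (use assms in \<open>simp add: psd_on_def\<close>)

lemma psd_on_scale:
  assumes "psd_on A f" "c \<in> \<real>\<^sub>\<ge>\<^sub>0"
  shows "psd_on A (\<lambda>x y. c * f x y)"
  using assms unfolding psd_on_def hs_inner_scale_right by simp

lemma psd_on_outer_prod: "psd_on A (outer_prod w)"
  unfolding psd_on_def hs_inner_outer_prod_outer_prod by (simp del: of_real_power)

lemma psd_on_congruence:
  assumes "psd_on A f"
  shows "psd_on B (\<lambda>x y. hs_inner A (\<lambda>a b. T a x * cnj (T b y)) f)"
proof -
  have "hs_inner B (outer_prod v) (\<lambda>x y. hs_inner A (\<lambda>a b. T a x * cnj (T b y)) f)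
      = hs_inner A (outer_prod (\<lambda>a. \<Sum>x\<in>B. v x * T a x)) f" for v
  proof -
    have "cnj (outer_prod (\<lambda>a. \<Sum>x\<in>B. v x * T a x) a b)
        = (\<Sum>(x, y)\<in>B \<times> B. cnj (outer_prod v x y) * cnj (T a x * cnj (T b y)))" for a b
      by (simp add: outer_prod_def sum_product sum.cartesian_product case_prod_unfold mult_ac)
    then show ?thesis
      unfolding hs_inner_def case_prod_unfold sum_distrib_left
      by (subst sum.swap) (simp add: sum_distrib_right mult.assoc case_prod_unfold)
  qed
  then show ?thesis using assms by (simp add: psd_on_def)
qed

lemma psd_on_reindex:
  assumes "psd_on A f" "finite A" "g ` B \<subseteq> A"
  shows "psd_on B (\<lambda>x y. f (g x) (g y))"
proof -
  let ?pullback = "\<lambda>x y. hs_inner A (\<lambda>a b. of_bool (a = g x) * cnj (of_bool (b = g y))) f"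
  have "psd_on B ?pullback"
    by (rule psd_on_congruence[OF assms(1), of B "\<lambda>a x. of_bool (a = g x)"])
  moreover have "?pullback x y = f (g x) (g y)" if "x \<in> B" "y \<in> B" for x y
    using assms(2,3) that
    by (simp add: hs_inner_def sum.cartesian_product[symmetric] image_subset_iff mult.assoc
        sum_distrib_left[symmetric])
  ultimately show ?thesis by (simp cong: psd_on_cong)
qed

lemma psd_on_diag:
  assumes "psd_on A f" "finite A" "x \<in> A"
  shows "f x x \<in> \<real>\<^sub>\<ge>\<^sub>0"
  using assms(1) hs_inner_outer_prod_unit[OF assms(2,3), of f] unfolding psd_on_def by metis

lemma psd_on_hermitian:
  assumes "psd_on A f" "finite A" "x \<in> A" "y \<in> A"
  shows "f y x = cnj (f x y)"
proof -
  have "f x x + c * f x y + cnj c * f y x + cnj c * c * f y y \<in> \<real>\<^sub>\<ge>\<^sub>0" for c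
    using assms(1) unfolding hs_inner_outer_prod_pair[OF assms(2-4), symmetric] psd_on_def by blast
  from this[of 1] this[of \<i>] show ?thesis
    using psd_on_diag[OF assms(1,2)] assms(3,4)
    by (auto simp: complex_nonneg_Reals_iff complex_eq_iff)
qed

lemma psd_on_norm_le_diag:
  assumes "psd_on A f" "finite A" "x \<in> A" "y \<in> A"
  shows "2 * cmod (f x y) \<le> Re (f x x) + Re (f y y)"
proof -
  define c where "c = - cnj (sgn (f x y))"
  have "c * f x y = - complex_of_real (cmod (f x y))"
    by (cases "f x y = 0")
      (auto simp: c_def sgn_div_norm scaleR_conv_of_real complex_norm_square[symmetric]
        power2_eq_square field_simps)
  moreover from this have "cnj c * f y x = - complex_of_real (cmod (f x y))"
    using psd_on_hermitian[OF assms]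
    by (metis complex_cnj_complex_of_real complex_cnj_minus complex_cnj_mult)
  moreover have "Re (cnj c * c * f y y) \<le> Re (f y y)"
  proof -
    have "cnj c * c = complex_of_real ((cmod (sgn (f x y)))\<^sup>2)"
      unfolding complex_norm_square c_def by simp
    then show ?thesis
      using psd_on_diag[OF assms(1,2,4)] by (simp add: norm_sgn complex_nonneg_Reals_iff)
  qed
  moreover have "0 \<le> Re (f x x + c * f x y + cnj c * f y x + cnj c * c * f y y)"
    using assms(1) unfolding hs_inner_outer_prod_pair[OF assms(2-4), symmetric] psd_on_def
    by (simp add: complex_nonneg_Reals_iff)
  ultimately show ?thesis by simp
qed

lemma psd_on_norm_le_trace:
  assumes "psd_on A f" "finite A" "x \<in> A" "y \<in> A"
  shows "cmod (f x y) \<le> Re (\<Sum>x\<in>A. f x x)"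
proof -
  have "Re (f z z) \<le> Re (\<Sum>x\<in>A. f x x)" if "z \<in> A" for z
    using member_le_sum[of z A "\<lambda>x. Re (f x x)"] psd_on_diag[OF assms(1,2)] assms(2) that
    by (simp add: complex_nonneg_Reals_iff)
  from this[OF assms(3)] this[OF assms(4)] psd_on_norm_le_diag[OF assms] show ?thesis by simp
qed

lemma hs_inner_outer_prod_eq_0_imp:
  assumes "finite A" "\<And>v. hs_inner A (outer_prod v) f = 0" "x \<in> A" "y \<in> A"
  shows "f x y = 0"
proof -
  have "psd_on A f" using assms(2) by (simp add: psd_on_def)
  moreover have "f z z = 0" if "z \<in> A" for z
    using hs_inner_outer_prod_unit[OF assms(1) that, of f] assms(2) by simp
  ultimately show ?thesis
    using psd_on_norm_le_diag[of A f x y] assms by simp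
qed

abbreviation complement :: "'a kernel \<Rightarrow> 'a kernel" where
  "complement J \<equiv> (\<lambda>x y. id_kernel x y - J x y)"

lemma psd_on_complement_outer_prod:
  assumes "finite A" "(\<Sum>x\<in>A. (cmod (v x))\<^sup>2) \<le> 1"
  shows "psd_on A (complement (outer_prod v))"
  unfolding psd_on_def
proof
  fix w
  have "cmod (\<Sum>x\<in>A. cnj (w x) * v x) \<le> (\<Sum>x\<in>A. \<bar>cmod (w x)\<bar> * \<bar>cmod (v x)\<bar>)"
    by (rule sum_norm_le) (simp add: norm_mult)
  also have "\<dots> \<le> L2_set (\<lambda>x. cmod (w x)) A * L2_set (\<lambda>x. cmod (v x)) A"
    by (rule L2_set_mult_ineq)
  also have "\<dots> \<le> L2_set (\<lambda>x. cmod (w x)) A * 1"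
    using assms(2) by (intro mult_left_mono) (simp_all add: L2_set_def sum_nonneg)
  finally have "(cmod (\<Sum>x\<in>A. cnj (w x) * v x))\<^sup>2 \<le> (\<Sum>x\<in>A. (cmod (w x))\<^sup>2)"
    by (intro sqrt_ge_absD) (simp add: L2_set_def)
  moreover have "hs_inner A (outer_prod w) id_kernel = complex_of_real (\<Sum>x\<in>A. (cmod (w x))\<^sup>2)"
    using assms(1) unfolding of_real_sum complex_norm_square hs_inner_outer_prod_eq_sum
    by (simp add: id_kernel_def of_bool_def if_distrib[of "\<lambda>z. z * _"] if_distrib[of "\<lambda>z. _ * z"]
        mult.commute cong: if_cong)
  ultimately show "hs_inner A (outer_prod w) (complement (outer_prod v)) \<in> \<real>\<^sub>\<ge>\<^sub>0"
    by (simp only: hs_inner_diff_right hs_inner_outer_prod_outer_prod of_real_diff[symmetric]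
        nonneg_Reals_of_real_iff diff_ge_0_iff_ge)
qed

lemma psd_on_id_kernel:
  assumes "finite A"
  shows "psd_on A id_kernel"
  using psd_on_complement_outer_prod[OF assms, of "\<lambda>_. 0"] by (simp add: outer_prod_def)

section \<open>Gram decompositions and rank\<close>

definition schur_complement :: "'a kernel \<Rightarrow> 'a \<Rightarrow> 'a kernel" where
  "schur_complement f l x y = f x y - f x l * f l y / f l l"

lemma psd_on_schur_complement:
  assumes psd: "psd_on A f" and "finite A" "l \<in> A"
  shows "psd_on A (schur_complement f l)"
proof -
  define T where "T a x = of_bool (a = x) + (- f l x / f l l) * of_bool (a = l)" for a x
  have "cnj (f l x) = f x l" if "x \<in> A" for x
    by (rule psd_on_hermitian[OF psd assms(2,3) that, symmetric])
  with this[OF assms(3)] have cnj_T: "cnj (T a x) = of_bool (a = x) + (- f x l / f l l) * of_bool (a = l)"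
    if "x \<in> A" for a x
    using that by (simp add: T_def)
  have "hs_inner A (\<lambda>a b. T a x * cnj (T b y)) f = schur_complement f l x y" if "x \<in> A" "y \<in> A" for x y
  proof -
    have "hs_inner A (\<lambda>a b. T a x * cnj (T b y)) f = (\<Sum>a\<in>A. cnj (T a x) * (\<Sum>b\<in>A. T b y * f a b))"
      by (simp add: hs_inner_def sum.cartesian_product[symmetric] sum_distrib_left mult.assoc)
    also have "\<dots> = (\<Sum>a\<in>A. cnj (T a x) * (f a y - f l y / f l l * f a l))"
      unfolding T_def sum_of_bool_pair[OF assms(2) that(2) assms(3)] by simp
    also have "\<dots> = schur_complement f l x y"
      unfolding cnj_T[OF that(1)] sum_of_bool_pair[OF assms(2) that(1) assms(3)]
      by (simp add: schur_complement_def)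
    finally show ?thesis .
  qed
  then show ?thesis
    using psd_on_congruence[OF psd, of A T] by (simp cong: psd_on_cong)
qed

lemma schur_complement_factorization:
  assumes f: "\<And>x y. x \<in> A \<Longrightarrow> y \<in> A \<Longrightarrow> f x y = (\<Sum>s\<in>insert r S. c s x * d s y)"
    and S: "finite S" "r \<notin> S" and l: "l \<in> A" "c r l \<noteq> 0" "f l l \<noteq> 0"
  obtains c' d' where "\<And>x y. x \<in> A \<Longrightarrow> y \<in> A \<Longrightarrow> schur_complement f l x y = (\<Sum>s\<in>S. c' s x * d' s y)"
proof
  define d' where "d' s y = d s y - d s l * f l y / f l l" for s y
  fix x y assume "x \<in> A" "y \<in> A"
  have factor: "schur_complement f l z y = c r z * d' r y + (\<Sum>s\<in>S. c s z * d' s y)" if "z \<in> A" for z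
    using f[OF that \<open>y \<in> A\<close>] f[OF that l(1)] S
    by (simp add: schur_complement_def d'_def algebra_simps sum_subtractf sum_distrib_left
        sum_divide_distrib add_divide_distrib)
  have "schur_complement f l l y = 0"
    using l(3) by (simp add: schur_complement_def)
  then have "d' r y = - (\<Sum>s\<in>S. c s l * d' s y) / c r l"
    using factor[OF l(1)] l(2) by (simp add: field_simps eq_neg_iff_add_eq_0)
  then have "c r x * d' r y = - (\<Sum>s\<in>S. c r x * c s l / c r l * d' s y)"
    by (simp add: sum_distrib_left sum_divide_distrib mult_ac)
  then show "schur_complement f l x y = (\<Sum>s\<in>S. (c s x - c r x * c s l / c r l) * d' s y)"
    unfolding factor[OF \<open>x \<in> A\<close>] by (simp add: left_diff_distrib sum_subtractf)
qed

lemma psd_on_eq_schur_complement_plus_outer_prod: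
  assumes psd: "psd_on A f" and "finite A" "l \<in> A"
  obtains v where "\<And>x y. x \<in> A \<Longrightarrow> y \<in> A \<Longrightarrow> f x y = schur_complement f l x y + outer_prod v x y"
proof
  define q where "q = complex_of_real (sqrt (Re (f l l)))"
  have "q * q = f l l"
    using psd_on_diag[OF assms] unfolding q_def of_real_mult[symmetric]
    by (simp add: complex_nonneg_Reals_iff complex_eq_iff)
  fix x y assume "x \<in> A" "y \<in> A"
  have "outer_prod (\<lambda>z. f z l / q) x y = f x l * f l y / (q * q)"
    using psd_on_hermitian[OF psd assms(2) \<open>y \<in> A\<close> assms(3)] by (simp add: outer_prod_def q_def)
  then show "f x y = schur_complement f l x y + outer_prod (\<lambda>z. f z l / q) x y"
    unfolding \<open>q * q = f l l\<close> by (simp add: schur_complement_def)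
qed

text \<open>Each Schur complement through a nonzero diagonal entry lowers the number of summands by one.\<close>

lemma psd_on_gram:
  assumes "finite S" "finite A" "psd_on A f"
    and "\<And>x y. x \<in> A \<Longrightarrow> y \<in> A \<Longrightarrow> f x y = (\<Sum>s\<in>S. c s x * d s y)"
  shows "\<exists>b. \<forall>x\<in>A. \<forall>y\<in>A. f x y = (\<Sum>s\<in>S. outer_prod (b s) x y)"
  using assms
proof (induction "card S" arbitrary: S f c d)
  case 0
  then show ?case by simp
next
  case (Suc r)
  show ?case
  proof (cases "\<forall>x\<in>A. f x x = 0")
    case True
    have "f x y = 0" if "x \<in> A" "y \<in> A" for x y
      using psd_on_norm_le_diag[OF Suc.prems(3,2) that] True that by simp
    then show ?thesis by (intro exI[of _ "\<lambda>_ _. 0"]) (simp add: outer_prod_def)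
  next
    case False
    then obtain l where l: "l \<in> A" "f l l \<noteq> 0" by auto
    obtain s where s: "s \<in> S" "c s l \<noteq> 0"
      using l Suc.prems(4)[OF l(1) l(1)] by (metis (no_types, lifting) mult_eq_0_iff sum.neutral)
    define S' where "S' = S - {s}"
    have S: "S = insert s S'" "s \<notin> S'" "finite S'" "card S' = r"
      using s Suc.hyps(2) Suc.prems(1) by (auto simp: S'_def)
    obtain c' d' where "\<And>x y. x \<in> A \<Longrightarrow> y \<in> A \<Longrightarrow> schur_complement f l x y = (\<Sum>s\<in>S'. c' s x * d' s y)"
      using schur_complement_factorization[where c = c and d = d,
          OF Suc.prems(4)[unfolded S(1)] S(3,2) l(1) s(2) l(2)] by blast
    then obtain b where b: "\<forall>x\<in>A. \<forall>y\<in>A. schur_complement f l x y = (\<Sum>s\<in>S'. outer_prod (b s) x y)"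
      using Suc.hyps(1)[OF S(4)[symmetric] S(3) Suc.prems(2)
          psd_on_schur_complement[OF Suc.prems(3,2) l(1)]] by blast
    obtain v where v: "\<And>x y. x \<in> A \<Longrightarrow> y \<in> A \<Longrightarrow> f x y = schur_complement f l x y + outer_prod v x y"
      using psd_on_eq_schur_complement_plus_outer_prod[OF Suc.prems(3,2) l(1)] by blast
    have "(\<Sum>t\<in>S. outer_prod ((b(s := v)) t) x y) = outer_prod v x y + (\<Sum>t\<in>S'. outer_prod (b t) x y)"
      for x y
      using S by (auto intro!: sum.cong)
    then have "\<forall>x\<in>A. \<forall>y\<in>A. f x y = (\<Sum>t\<in>S. outer_prod ((b(s := v)) t) x y)"
      using b v by simp
    then show ?thesis by blast
  qed
qed

lemma psd_on_eq_sum_outer_prod: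
  assumes "finite A" "psd_on A f"
  obtains b where "\<And>x y. x \<in> A \<Longrightarrow> y \<in> A \<Longrightarrow> f x y = (\<Sum>s\<in>A. outer_prod (b s) x y)"
proof -
  have "f x y = (\<Sum>s\<in>A. of_bool (x = s) * f s y)" if "x \<in> A" for x y
    using assms(1) that by simp
  then show ?thesis
    using psd_on_gram[OF assms(1,1,2), of "\<lambda>s x. of_bool (x = s)" f] that by blast
qed

lemma (in vec_space) maximal_lin_indpt_span:
  assumes "A \<in> carrier_mat n nc" "maximal S (\<lambda>T. T \<subseteq> set (cols A) \<and> lin_indpt T)" "j < nc"
  shows "col A j \<in> span S"
proof (rule ccontr)
  assume not_span: "col A j \<notin> span S"
  have "S \<subseteq> set (cols A)" "lin_indpt S" using assms(2) by (auto simp: maximal_def)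
  moreover have "set (cols A) \<subseteq> carrier_vec n" "col A j \<in> set (cols A)"
    using assms(1,3) cols_dim by (auto simp: cols_def)
  moreover have "col A j \<notin> S"
    using not_span in_own_span[of S] calculation by auto
  ultimately have "lin_indpt (insert (col A j) S)" "insert (col A j) S \<subseteq> set (cols A)"
    using lin_dep_iff_in_span[of S "col A j"] not_span by auto
  then have "insert (col A j) S = S" using assms(2) unfolding maximal_def by blast
  then show False using \<open>col A j \<notin> S\<close> by blast
qed

lemma mat_rank_factorization:
  assumes "A \<in> carrier_mat n nc"
  obtains S :: "complex vec set" and c d where "finite S" "card S = mat_rank n A"
    "\<And>i j. i < n \<Longrightarrow> j < nc \<Longrightarrow> A $$ (i,j) = (\<Sum>v\<in>S. c v i * d v j)"
proof -
  interpret vec_space "TYPE(complex)" n .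
  have "lin_indpt {}" by (simp add: lin_dep_def)
  then obtain S where S: "finite S" "maximal S (\<lambda>T. T \<subseteq> set (cols A) \<and> lin_indpt T)"
    using maximal_exists_superset[of "set (cols A)" "\<lambda>T. T \<subseteq> set (cols A) \<and> lin_indpt T" "{}"] by auto
  have "set (cols A) \<subseteq> carrier_vec n" using assms cols_dim by blast
  then have carrier: "S \<subseteq> carrier_vec n" using S(2) by (auto simp: maximal_def)
  have "\<exists>a. \<forall>i<n. A $$ (i,j) = (\<Sum>v\<in>S. v $ i * a v)" if "j < nc" for j
  proof -
    obtain a where "lincomb a S = col A j"
      using finite_in_span[OF S(1) carrier maximal_lin_indpt_span[OF assms S(2) \<open>j < nc\<close>]] by auto
    then have "A $$ (i,j) = (\<Sum>v\<in>S. v $ i * a v)" if "i < n" for i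
      using lincomb_index[OF that carrier, of a] that \<open>j < nc\<close> assms by (simp add: mult.commute)
    then show ?thesis by blast
  qed
  then obtain a where "\<And>i j. i < n \<Longrightarrow> j < nc \<Longrightarrow> A $$ (i,j) = (\<Sum>v\<in>S. v $ i * a j v)" by metis
  then show ?thesis
    using that[of S vec_index "\<lambda>v j. a j v"] S(1) rank_card_indpt[OF assms S(2)]
    by (simp add: mat_rank_def)
qed

lemma mat_rank_sum_le_card:
  assumes "finite S"
  shows "mat_rank n (mat n nc (\<lambda>(i,j). \<Sum>s\<in>S. c s i * d s j)) \<le> card S"
  using assms
proof (induction S rule: finite_induct)
  case empty
  have "mat n nc (\<lambda>(i,j). \<Sum>s\<in>{}. c s i * d s j) = 0\<^sub>m n nc" by (rule eq_matI) auto
  then show ?case using vec_space.rank_0I[of n nc] by (simp only: mat_rank_def card.empty le_zero_eq)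
next
  case (insert r S)
  let ?A = "mat n nc (\<lambda>(i,j). \<Sum>s\<in>S. c s i * d s j)" and ?B = "mat n nc (\<lambda>(i,j). c r i * d r j)"
  have "mat n nc (\<lambda>(i,j). \<Sum>s\<in>insert r S. c s i * d s j) = ?B + ?A"
    using insert.hyps by (intro eq_matI) auto
  moreover have "vec_space.rank n (?B + ?A) \<le> vec_space.rank n ?B + vec_space.rank n ?A"
    by (rule vec_space.rank_subadditive) auto
  moreover have "vec_space.rank n ?B \<le> 1"
    by (rule vec_space.rank_le_1_product_entries[where f = "c r" and g = "d r" and nc = nc]) auto
  ultimately show ?case using insert by (simp add: mat_rank_def)
qed

abbreviation entries :: "complex mat \<Rightarrow> nat kernel" where
  "entries A \<equiv> (\<lambda>i j. A $$ (i,j))"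

lemma psd_mat_iff_psd_on: "psd_mat n A \<longleftrightarrow> A \<in> carrier_mat n n \<and> psd_on {..<n} (entries A)"
  by (simp add: psd_mat_def psd_on_def hs_inner_outer_prod_eq_sum nonneg_Reals_iff_Reals Let_def)

lemma psd_mat_rank_gram:
  assumes "psd_mat n \<rho>" "mat_rank n \<rho> \<le> k"
  obtains b where "\<And>i j. i < n \<Longrightarrow> j < n \<Longrightarrow> \<rho> $$ (i,j) = (\<Sum>s<k. outer_prod (b s) i j)"
proof -
  have \<rho>: "\<rho> \<in> carrier_mat n n" "psd_on {..<n} (entries \<rho>)"
    using assms(1) by (auto simp: psd_mat_iff_psd_on)
  obtain S :: "complex vec set" and c d where S: "finite S" "card S = mat_rank n \<rho>"
    and "\<And>i j. i < n \<Longrightarrow> j < n \<Longrightarrow> \<rho> $$ (i,j) = (\<Sum>v\<in>S. c v i * d v j)"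
    using mat_rank_factorization[OF \<rho>(1)] by metis
  then obtain g where g: "\<And>i j. i < n \<Longrightarrow> j < n \<Longrightarrow> \<rho> $$ (i,j) = (\<Sum>v\<in>S. outer_prod (g v) i j)"
    using psd_on_gram[where S = S and c = c and d = d, OF S(1) _ \<rho>(2)] by auto
  obtain e where e: "bij_betw e {..<card S} S"
    using ex_bij_betw_nat_finite[OF S(1)] by (auto simp: atLeast0LessThan)
  define b where "b s = (if s < card S then g (e s) else (\<lambda>_. 0))" for s
  have "\<rho> $$ (i,j) = (\<Sum>s<k. outer_prod (b s) i j)" if "i < n" "j < n" for i j
  proof -
    have "(\<Sum>s<k. outer_prod (b s) i j) = (\<Sum>s<card S. outer_prod (g (e s)) i j)"
      by (rule sum.mono_neutral_cong_right) (use S(2) assms(2) in \<open>auto simp: b_def outer_prod_def\<close>)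
    also have "\<dots> = (\<Sum>v\<in>S. outer_prod (g v) i j)"
      by (rule sum.reindex_bij_betw[OF e])
    finally show ?thesis using g[OF that] by simp
  qed
  then show ?thesis using that by blast
qed

section \<open>Operators on words and contraction of the last party\<close>

definition words :: "'a set \<Rightarrow> nat \<Rightarrow> 'a list set" where
  "words D N = {xs. length xs = N \<and> set xs \<subseteq> D}"

lemma multi_idx_eq_words: "multi_idx n k N = words (party_idx n k) N"
  by (simp add: multi_idx_def words_def)

lemma length_words: "xs \<in> words D N \<Longrightarrow> length xs = N"
  by (simp add: words_def)

lemma finite_words [simp]: "finite D \<Longrightarrow> finite (words D N)"
  using finite_lists_length_eq[of D N] by (simp add: words_def conj_commute)

lemma words_0 [simp]: "words D 0 = {[]}"
  by (auto simp: words_def)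

lemma Cons_in_words [simp]: "x # xs \<in> words D (Suc N) \<longleftrightarrow> x \<in> D \<and> xs \<in> words D N"
  by (auto simp: words_def)

lemma snoc_in_words [simp]: "xs @ [x] \<in> words D (Suc N) \<longleftrightarrow> x \<in> D \<and> xs \<in> words D N"
  by (auto simp: words_def)

lemma words_mset: "xs \<in> words D N \<Longrightarrow> mset ys = mset xs \<Longrightarrow> ys \<in> words D N"
  by (metis (mono_tags, lifting) mem_Collect_eq mset_eq_setD size_mset words_def)

lemma sum_words_Suc:
  "(\<Sum>xs\<in>words D (Suc N). f xs) = (\<Sum>x\<in>D. \<Sum>xs\<in>words D N. f (x # xs))"
proof -
  have "bij_betw (\<lambda>(x, xs). x # xs) (D \<times> words D N) (words D (Suc N))"
    unfolding bij_betw_def by (auto simp: inj_on_def image_def words_def length_Suc_conv)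
  from sum.reindex_bij_betw[OF this, of f] show ?thesis
    by (simp add: sum.cartesian_product case_prod_unfold)
qed

definition contract_last :: "'a set \<Rightarrow> 'a kernel \<Rightarrow> 'a list kernel \<Rightarrow> 'a list kernel" where
  "contract_last D J \<Phi> xs ys = hs_inner D J (\<lambda>a b. \<Phi> (xs @ [a]) (ys @ [b]))"

abbreviation partial_trace :: "'a set \<Rightarrow> 'a list kernel \<Rightarrow> 'a list kernel" where
  "partial_trace D \<equiv> contract_last D id_kernel"

lemma funpow_partial_trace:
  assumes "finite D"
  shows "(partial_trace D ^^ N) \<Phi> xs ys = (\<Sum>zs\<in>words D N. \<Phi> (xs @ zs) (ys @ zs))"
  using assms
  by (induction N arbitrary: xs ys) (simp_all add: contract_last_def hs_inner_id_kernel sum_words_Suc)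

lemma hs_inner_contract_last_outer_prod:
  "hs_inner (words D N) (outer_prod u) (contract_last D (outer_prod v) \<Phi>)
    = hs_inner (words D (Suc N)) (outer_prod (\<lambda>zs. u (butlast zs) * v (last zs))) \<Phi>"
proof -
  have snoc: "butlast zs \<in> words D N" "last zs \<in> D" "zs \<noteq> []" if "zs \<in> words D (Suc N)" for zs
    using that by (cases zs rule: rev_cases; auto simp: words_def)+
  show ?thesis
    unfolding hs_inner_def contract_last_def sum_distrib_left case_prod_unfold sum.cartesian_product
    by (rule sum.reindex_bij_witness[where j = "\<lambda>((xs, ys), a, b). (xs @ [a], ys @ [b])"
          and i = "\<lambda>(zs, zs'). ((butlast zs, butlast zs'), last zs, last zs')"])
      (auto simp: snoc outer_prod_def mult_ac)
qed

lemma psd_on_contract_last: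
  assumes "finite D" and \<Phi>: "psd_on (words D (Suc N)) \<Phi>" and "psd_on D J"
  shows "psd_on (words D N) (contract_last D J \<Phi>)"
proof -
  obtain b where b: "\<And>x y. x \<in> D \<Longrightarrow> y \<in> D \<Longrightarrow> J x y = (\<Sum>s\<in>D. outer_prod (b s) x y)"
    using psd_on_eq_sum_outer_prod[OF assms(1,3)] by blast
  have "contract_last D J \<Phi> xs ys = (\<Sum>s\<in>D. contract_last D (outer_prod (b s)) \<Phi> xs ys)" for xs ys
    unfolding contract_last_def hs_inner_sum_left[symmetric] by (rule hs_inner_cong) (simp_all add: b)
  moreover have "psd_on (words D N) (contract_last D (outer_prod v) \<Phi>)" for v
    using \<Phi> unfolding psd_on_def hs_inner_contract_last_outer_prod by blast
  ultimately show ?thesis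
    by (simp add: psd_on_sum cong: psd_on_cong)
qed

definition word_sym :: "'a set \<Rightarrow> nat \<Rightarrow> 'a list kernel \<Rightarrow> bool" where
  "word_sym D N \<Phi> \<longleftrightarrow> (\<forall>xs\<in>words D N. \<forall>ys\<in>words D N. \<forall>xs' ys'.
     mset xs' = mset xs \<longrightarrow> mset ys' = mset ys \<longrightarrow> \<Phi> xs' ys' = \<Phi> xs ys)"

lemma word_symD:
  assumes "word_sym D N \<Phi>" "xs \<in> words D N" "ys \<in> words D N" "mset xs' = mset xs" "mset ys' = mset ys"
  shows "\<Phi> xs' ys' = \<Phi> xs ys"
  using assms unfolding word_sym_def by blast

lemma word_sym_cong:
  assumes "\<And>xs ys. xs \<in> words D N \<Longrightarrow> ys \<in> words D N \<Longrightarrow> \<Phi> xs ys = \<Psi> xs ys"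
  shows "word_sym D N \<Phi> \<longleftrightarrow> word_sym D N \<Psi>"
proof -
  have "\<Phi> xs' ys' = \<Phi> xs ys \<longleftrightarrow> \<Psi> xs' ys' = \<Psi> xs ys"
    if "xs \<in> words D N" "ys \<in> words D N" "mset xs' = mset xs" "mset ys' = mset ys" for xs ys xs' ys'
    using assms[OF that(1,2)] assms[OF words_mset[OF that(1,3)] words_mset[OF that(2,4)]] by simp
  then show ?thesis
    unfolding word_sym_def by (intro ball_cong iff_allI imp_cong refl)
qed

lemma word_sym_contract_last:
  assumes "word_sym D (Suc N) \<Phi>"
  shows "word_sym D N (contract_last D J \<Phi>)"
  unfolding word_sym_def
proof (intro ballI allI impI)
  fix xs ys xs' ys'
  assume perm: "xs \<in> words D N" "ys \<in> words D N" "mset xs' = mset xs" "mset ys' = mset ys"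
  have "\<Phi> (xs' @ [a]) (ys' @ [b]) = \<Phi> (xs @ [a]) (ys @ [b])" if "a \<in> D" "b \<in> D" for a b
    by (rule word_symD[OF assms]) (use perm that in simp_all)
  then show "contract_last D J \<Phi> xs' ys' = contract_last D J \<Phi> xs ys"
    unfolding contract_last_def by (rule hs_inner_cong[OF refl])
qed

section \<open>Symmetric extensions\<close>

text \<open>N counts the parties besides the first one. A linear constraint on the first party is encoded
  by a kernel K to which the operator is orthogonal in that party.\<close>

definition ext_cone :: "'a set \<Rightarrow> 'a kernel set \<Rightarrow> nat \<Rightarrow> 'a list kernel \<Rightarrow> bool" where
  "ext_cone D \<K> N \<Phi> \<longleftrightarrow> psd_on (words D (Suc N)) \<Phi> \<and> word_sym D (Suc N) \<Phi> \<and>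
     (\<forall>K\<in>\<K>. \<forall>xs\<in>words D N. \<forall>ys\<in>words D N. hs_inner D K (\<lambda>x y. \<Phi> (x # xs) (y # ys)) = 0)"

definition ext_feasible :: "'a set \<Rightarrow> 'a kernel set \<Rightarrow> nat \<Rightarrow> 'a list kernel \<Rightarrow> bool" where
  "ext_feasible D \<K> N \<Phi> \<longleftrightarrow> ext_cone D \<K> N \<Phi> \<and> (partial_trace D ^^ Suc N) \<Phi> [] [] = 1"

definition one_body :: "'a list kernel \<Rightarrow> 'a kernel" where
  "one_body \<Phi> x y = \<Phi> [x] [y]"

abbreviation marginal :: "'a set \<Rightarrow> nat \<Rightarrow> 'a list kernel \<Rightarrow> 'a kernel" where
  "marginal D N \<Phi> \<equiv> one_body ((partial_trace D ^^ N) \<Phi>)"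

lemma psd_on_one_body:
  assumes "finite D" "psd_on (words D (Suc 0)) \<Phi>"
  shows "psd_on D (one_body \<Phi>)"
proof -
  have "psd_on D (\<lambda>x y. \<Phi> [x] [y])"
    by (rule psd_on_reindex[OF assms(2)]) (use assms(1) in auto)
  then show ?thesis by (simp add: one_body_def[abs_def])
qed

lemma ext_cone_cong:
  assumes "\<And>xs ys. xs \<in> words D (Suc N) \<Longrightarrow> ys \<in> words D (Suc N) \<Longrightarrow> \<Phi> xs ys = \<Psi> xs ys"
  shows "ext_cone D \<K> N \<Phi> \<longleftrightarrow> ext_cone D \<K> N \<Psi>"
proof -
  have "psd_on (words D (Suc N)) \<Phi> \<longleftrightarrow> psd_on (words D (Suc N)) \<Psi>"
    by (rule psd_on_cong) (rule assms)
  moreover have "word_sym D (Suc N) \<Phi> \<longleftrightarrow> word_sym D (Suc N) \<Psi>"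
    by (rule word_sym_cong) (rule assms)
  moreover have "hs_inner D K (\<lambda>x y. \<Phi> (x # xs) (y # ys)) = hs_inner D K (\<lambda>x y. \<Psi> (x # xs) (y # ys))"
    if "xs \<in> words D N" "ys \<in> words D N" for K xs ys
    by (rule hs_inner_cong[OF refl], rule assms) (simp_all add: that)
  ultimately show ?thesis unfolding ext_cone_def by simp
qed

lemma ext_cone_orthogonal:
  assumes "ext_cone D \<K> N \<Phi>" "K \<in> \<K>" "xs \<in> words D N" "ys \<in> words D N"
  shows "hs_inner D K (\<lambda>x y. \<Phi> (x # xs) (y # ys)) = 0"
  using assms by (simp add: ext_cone_def)

lemma ext_cone_contract_last:
  assumes "finite D" "ext_cone D \<K> (Suc N) \<Phi>" "psd_on D J"
  shows "ext_cone D \<K> N (contract_last D J \<Phi>)"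
  unfolding ext_cone_def
proof (intro conjI ballI)
  show "psd_on (words D (Suc N)) (contract_last D J \<Phi>)" "word_sym D (Suc N) (contract_last D J \<Phi>)"
    using assms psd_on_contract_last word_sym_contract_last by (auto simp: ext_cone_def)
  fix K xs ys assume "K \<in> \<K>" "xs \<in> words D N" "ys \<in> words D N"
  have "hs_inner D K (\<lambda>x y. contract_last D J \<Phi> (x # xs) (y # ys))
      = hs_inner D J (\<lambda>a b. hs_inner D K (\<lambda>x y. \<Phi> (x # xs @ [a]) (y # ys @ [b])))"
    unfolding contract_last_def append_Cons by (rule hs_inner_commute)
  also have "\<dots> = hs_inner D J (\<lambda>a b. 0)"
    by (rule hs_inner_cong[OF refl], rule ext_cone_orthogonal[OF assms(2) \<open>K \<in> \<K>\<close>])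
      (simp_all add: \<open>xs \<in> words D N\<close> \<open>ys \<in> words D N\<close>)
  finally show "hs_inner D K (\<lambda>x y. contract_last D J \<Phi> (x # xs) (y # ys)) = 0"
    by (simp add: hs_inner_def)
qed

lemma ext_cone_scale:
  assumes "ext_cone D \<K> N \<Phi>" "c \<in> \<real>\<^sub>\<ge>\<^sub>0"
  shows "ext_cone D \<K> N (\<lambda>xs ys. c * \<Phi> xs ys)"
proof -
  have "word_sym D (Suc N) (\<lambda>xs ys. c * \<Phi> xs ys)"
    using assms(1) word_symD[of D "Suc N" \<Phi>] unfolding ext_cone_def word_sym_def by metis
  then show ?thesis
    using assms psd_on_scale unfolding ext_cone_def hs_inner_scale_right by auto
qed

lemma ext_cone_funpow_partial_trace:
  assumes "finite D"
  shows "ext_cone D \<K> (N + j) \<Phi> \<Longrightarrow> ext_cone D \<K> N ((partial_trace D ^^ j) \<Phi>)"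
proof (induction j arbitrary: \<Phi>)
  case (Suc j)
  then show ?case
    using ext_cone_contract_last[OF assms, of \<K> "N + j" \<Phi>] psd_on_id_kernel[OF assms]
    by (simp add: funpow_swap1)
qed simp

lemma ext_feasible_funpow_partial_trace:
  assumes "finite D" "ext_feasible D \<K> (N + j) \<Phi>"
  shows "ext_feasible D \<K> N ((partial_trace D ^^ j) \<Phi>)"
proof -
  have "(partial_trace D ^^ Suc N) ((partial_trace D ^^ j) \<Phi>) = (partial_trace D ^^ Suc (N + j)) \<Phi>"
    by (simp add: funpow_add)
  then show ?thesis
    using assms ext_cone_funpow_partial_trace unfolding ext_feasible_def by metis
qed

lemma ext_feasible_norm_le_1:
  assumes "finite D" "ext_feasible D \<K> N \<Phi>" "xs \<in> words D (Suc N)" "ys \<in> words D (Suc N)"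
  shows "cmod (\<Phi> xs ys) \<le> 1"
  using psd_on_norm_le_trace[of "words D (Suc N)" \<Phi> xs ys] assms
  by (simp add: ext_feasible_def ext_cone_def funpow_partial_trace del: funpow.simps Re_sum)

section \<open>Exchangeable states\<close>

text \<open>A kernel on words of all lengths holds the states of all finite sets of parties at once.
  Requiring it to vanish on words of different lengths or outside D makes the set of these states
  compact.\<close>

definition ext_states :: "'a set \<Rightarrow> 'a kernel set \<Rightarrow> nat \<Rightarrow> 'a list kernel set" where
  "ext_states D \<K> M = {\<Phi>. \<Phi> [] [] = 1 \<and>
     (\<forall>xs ys. (\<forall>N. xs \<notin> words D N \<or> ys \<notin> words D N) \<longrightarrow> \<Phi> xs ys = 0) \<and>
     (\<forall>N<M. ext_cone D \<K> N \<Phi> \<and> (\<forall>xs\<in>words D N. \<forall>ys\<in>words D N. partial_trace D \<Phi> xs ys = \<Phi> xs ys))}"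

definition exch_states :: "'a set \<Rightarrow> 'a kernel set \<Rightarrow> 'a list kernel set" where
  "exch_states D \<K> = (\<Inter>M. ext_states D \<K> M)"

definition bounded_kernels :: "('b \<Rightarrow> 'c \<Rightarrow> complex) set" where
  "bounded_kernels = {f. \<forall>x y. cmod (f x y) \<le> 1}"

lemma ext_statesD:
  assumes "\<Phi> \<in> ext_states D \<K> M"
  shows "\<Phi> [] [] = 1" and "N < M \<Longrightarrow> ext_cone D \<K> N \<Phi>"
    and "N < M \<Longrightarrow> xs \<in> words D N \<Longrightarrow> ys \<in> words D N \<Longrightarrow> partial_trace D \<Phi> xs ys = \<Phi> xs ys"
    and "\<forall>N. xs \<notin> words D N \<or> ys \<notin> words D N \<Longrightarrow> \<Phi> xs ys = 0"
  using assms unfolding ext_states_def by blast+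

lemma exch_states_iff:
  "\<Phi> \<in> exch_states D \<K> \<longleftrightarrow> \<Phi> [] [] = 1 \<and>
     (\<forall>xs ys. (\<forall>N. xs \<notin> words D N \<or> ys \<notin> words D N) \<longrightarrow> \<Phi> xs ys = 0) \<and>
     (\<forall>N. ext_cone D \<K> N \<Phi> \<and> (\<forall>xs\<in>words D N. \<forall>ys\<in>words D N. partial_trace D \<Phi> xs ys = \<Phi> xs ys))"
  unfolding exch_states_def ext_states_def by (simp, meson lessI)

lemma exch_statesD:
  assumes "\<Phi> \<in> exch_states D \<K>"
  shows "\<Phi> [] [] = 1" and "ext_cone D \<K> N \<Phi>"
    and "xs \<in> words D N \<Longrightarrow> ys \<in> words D N \<Longrightarrow> partial_trace D \<Phi> xs ys = \<Phi> xs ys"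
    and "\<forall>N. xs \<notin> words D N \<or> ys \<notin> words D N \<Longrightarrow> \<Phi> xs ys = 0"
  using assms unfolding exch_states_iff by blast+

lemma compact_PiE_UNIV:
  fixes S :: "'i \<Rightarrow> 'b::topological_space set"
  assumes "\<And>i. compact (S i)"
  shows "compact (PiE UNIV S)"
  using assms compactin_PiE[of "\<lambda>_. euclidean" UNIV S] unfolding euclidean_product_topology by simp

lemma compact_bounded_kernels: "compact (bounded_kernels :: ('b \<Rightarrow> 'c \<Rightarrow> complex) set)"
proof -
  have "(bounded_kernels :: ('b \<Rightarrow> 'c \<Rightarrow> complex) set) = PiE UNIV (\<lambda>_. PiE UNIV (\<lambda>_. cball 0 1))"
    by (auto simp: bounded_kernels_def PiE_UNIV_domain Pi_iff)
  then show ?thesis by (metis compact_PiE_UNIV compact_cball)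
qed

lemma continuous_on_kernel_entry [continuous_intros]:
  "continuous_on S (\<lambda>f :: 'b \<Rightarrow> 'c \<Rightarrow> complex. f x y)"
  by (rule continuous_on_product_then_coordinatewise, rule continuous_on_product_then_coordinatewise,
      rule continuous_on_id)

lemma continuous_on_hs_inner [continuous_intros]:
  assumes "\<And>x y. continuous_on S (\<lambda>\<Phi>. g \<Phi> x y)"
  shows "continuous_on S (\<lambda>\<Phi>. hs_inner A f (g \<Phi>))"
  unfolding hs_inner_def case_prod_unfold by (intro continuous_intros assms)

lemma closed_psd_on: "closed {f. psd_on A f}"
proof -
  have "closed {f. hs_inner A (outer_prod v) f \<in> \<real>\<^sub>\<ge>\<^sub>0}" for v
    using closed_vimage[OF closed_nonneg_Reals_complex, of "\<lambda>f. hs_inner A (outer_prod v) f"]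
    by (simp add: vimage_def continuous_intros)
  then show ?thesis unfolding psd_on_def by (rule closed_Collect_all)
qed

lemma closed_ext_cone: "closed {\<Phi>. ext_cone D \<K> N \<Phi>}"
  unfolding ext_cone_def word_sym_def Ball_def
  by (intro closed_Collect_conj closed_psd_on closed_Collect_all closed_Collect_imp closed_Collect_eq
      open_Collect_const continuous_intros)

lemma closed_ext_states: "closed (ext_states D \<K> M)"
  unfolding ext_states_def contract_last_def Ball_def
  by (intro closed_Collect_conj closed_ext_cone closed_Collect_all closed_Collect_imp closed_Collect_eq
      open_Collect_const continuous_intros)

lemma ext_states_antimono: "M \<le> M' \<Longrightarrow> ext_states D \<K> M' \<subseteq> ext_states D \<K> M"
  unfolding ext_states_def by (auto dest: order.strict_trans2)

lemma ext_states_funpow_partial_trace: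
  assumes "\<Phi> \<in> ext_states D \<K> M" "j + i \<le> M" "xs \<in> words D j" "ys \<in> words D j"
  shows "(partial_trace D ^^ i) \<Phi> xs ys = \<Phi> xs ys"
  using assms(2-)
proof (induction i arbitrary: j xs ys)
  case (Suc i)
  have "(partial_trace D ^^ Suc i) \<Phi> xs ys = partial_trace D \<Phi> xs ys"
    unfolding funpow.simps o_def contract_last_def[of D _ "(partial_trace D ^^ i) \<Phi>"]
      contract_last_def[of D _ \<Phi>]
    by (rule hs_inner_cong[OF refl], rule Suc.IH[of "Suc j"]) (use Suc.prems in simp_all)
  then show ?case
    using ext_statesD(3)[OF assms(1) _ Suc.prems(2,3)] Suc.prems(1) by simp
qed simp

lemma ext_states_norm_le_1:
  assumes "finite D" and \<Phi>: "\<Phi> \<in> ext_states D \<K> M" and "j \<le> M" "xs \<in> words D j" "ys \<in> words D j"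
  shows "cmod (\<Phi> xs ys) \<le> 1"
proof (cases j)
  case 0
  then show ?thesis using assms(4,5) ext_statesD(1)[OF \<Phi>] by simp
next
  case (Suc N)
  then have "ext_feasible D \<K> N \<Phi>"
    using ext_statesD(1,2)[OF \<Phi>] ext_states_funpow_partial_trace[OF \<Phi>, of 0 "Suc N" "[]" "[]"] assms(3)
    by (simp add: ext_feasible_def del: funpow.simps)
  then show ?thesis
    using ext_feasible_norm_le_1[OF assms(1)] assms(4,5) Suc by blast
qed

lemma exch_states_subset_bounded_kernels:
  assumes "finite D"
  shows "exch_states D \<K> \<subseteq> bounded_kernels"
proof
  fix \<Phi> assume \<Phi>: "\<Phi> \<in> exch_states D \<K>"
  have "cmod (\<Phi> xs ys) \<le> 1" for xs ys
  proof (cases "\<exists>N. xs \<in> words D N \<and> ys \<in> words D N")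
    case True
    then obtain N where "xs \<in> words D N" "ys \<in> words D N" by blast
    moreover have "\<Phi> \<in> ext_states D \<K> N" using \<Phi> by (simp add: exch_states_def)
    ultimately show ?thesis by (intro ext_states_norm_le_1[OF assms _ order_refl])
  qed (use exch_statesD(4)[OF \<Phi>, of xs ys] in auto)
  then show "\<Phi> \<in> bounded_kernels" by (simp add: bounded_kernels_def)
qed

lemma compact_exch_states:
  assumes "finite D"
  shows "compact (exch_states D \<K>)"
proof -
  have "closed (exch_states D \<K>)"
    unfolding exch_states_def by (intro closed_INT ballI closed_ext_states)
  then show ?thesis
    using compact_Int_closed[OF compact_bounded_kernels] exch_states_subset_bounded_kernels[OF assms]
    by (metis inf.absorb_iff2)
qed

definition marginal_states :: "'a set \<Rightarrow> nat \<Rightarrow> 'a list kernel \<Rightarrow> 'a list kernel" where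
  "marginal_states D M \<Phi> xs ys = (if \<exists>j\<le>M. xs \<in> words D j \<and> ys \<in> words D j
    then (partial_trace D ^^ (M - length xs)) \<Phi> xs ys else 0)"

lemma marginal_states_words:
  assumes "j \<le> M" "xs \<in> words D j" "ys \<in> words D j"
  shows "marginal_states D M \<Phi> xs ys = (partial_trace D ^^ (M - j)) \<Phi> xs ys"
  using assms length_words[OF assms(2)] by (auto simp: marginal_states_def)

lemma one_body_marginal_states:
  assumes "x \<in> D" "y \<in> D"
  shows "one_body (marginal_states D (Suc N) \<Phi>) x y = marginal D N \<Phi> x y"
  using marginal_states_words[of 1 "Suc N" "[x]" D "[y]"] assms by (simp add: one_body_def words_def)

lemma marginal_states_in_ext_states:
  assumes D: "finite D" and \<Phi>: "ext_feasible D \<K> N \<Phi>"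
  shows "marginal_states D (Suc N) \<Phi> \<in> ext_states D \<K> (Suc N)"
proof -
  let ?\<Psi> = "marginal_states D (Suc N) \<Phi>"
  have unit: "?\<Psi> [] [] = 1"
    using \<Phi> marginal_states_words[of 0 "Suc N" "[]" D "[]"] by (simp add: ext_feasible_def)
  have cone: "ext_cone D \<K> j ?\<Psi>" if "j \<le> N" for j
  proof -
    have "ext_cone D \<K> j ?\<Psi> \<longleftrightarrow> ext_cone D \<K> j ((partial_trace D ^^ (N - j)) \<Phi>)"
      by (rule ext_cone_cong) (use marginal_states_words[of "Suc j" "Suc N" _ D] that in simp)
    then show ?thesis
      using ext_cone_funpow_partial_trace[OF D, of \<K> j "N - j" \<Phi>] \<Phi> that by (simp add: ext_feasible_def)
  qed
  have consistent: "partial_trace D ?\<Psi> xs ys = ?\<Psi> xs ys"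
    if "j \<le> N" "xs \<in> words D j" "ys \<in> words D j" for j xs ys
  proof -
    have "partial_trace D ?\<Psi> xs ys = partial_trace D ((partial_trace D ^^ (N - j)) \<Phi>) xs ys"
      unfolding contract_last_def[of D _ ?\<Psi>] contract_last_def[of D _ "(partial_trace D ^^ (N - j)) \<Phi>"]
      by (rule hs_inner_cong[OF refl]) (use marginal_states_words[of "Suc j" "Suc N" _ D] that in simp)
    then show ?thesis
      using marginal_states_words[of j "Suc N" xs D ys] that by (simp add: Suc_diff_le)
  qed
  show ?thesis
    unfolding ext_states_def using unit cone consistent by (auto simp: less_Suc_eq_le marginal_states_def)
qed

lemma marginal_states_in_bounded_kernels:
  assumes "finite D" "ext_feasible D \<K> N \<Phi>"
  shows "marginal_states D (Suc N) \<Phi> \<in> bounded_kernels"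
proof -
  have "cmod (marginal_states D (Suc N) \<Phi> xs ys) \<le> 1" for xs ys
  proof (cases "\<exists>j\<le>Suc N. xs \<in> words D j \<and> ys \<in> words D j")
    case True
    then show ?thesis
      using ext_states_norm_le_1[OF assms(1) marginal_states_in_ext_states[OF assms]] by blast
  qed (auto simp: marginal_states_def)
  then show ?thesis by (simp add: bounded_kernels_def)
qed

lemma exch_states_value_ge:
  assumes "finite D"
    and "\<And>N. \<exists>\<Phi>. ext_feasible D \<K> N \<Phi> \<and> c \<le> Re (hs_inner D W (marginal D N \<Phi>))"
  obtains \<Phi> where "\<Phi> \<in> exch_states D \<K>" "c \<le> Re (hs_inner D W (one_body \<Phi>))"
proof -
  define F where "F M = ext_states D \<K> M \<inter> {\<Phi>. c \<le> Re (hs_inner D W (one_body \<Phi>))}" for M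
  have "bounded_kernels \<inter> (\<Inter>M. F M) \<noteq> {}"
  proof (rule compact_imp_fip_image[OF compact_bounded_kernels])
    show "closed (F M)" for M
      unfolding F_def one_body_def
      by (intro closed_Int closed_ext_states closed_Collect_le continuous_intros)
    fix I :: "nat set" assume "finite I"
    obtain N where N: "\<And>M. M \<in> I \<Longrightarrow> M \<le> Suc N"
      using finite_nat_set_iff_bounded_le[of I] \<open>finite I\<close> le_SucI by blast
    obtain \<Phi> where \<Phi>: "ext_feasible D \<K> N \<Phi>" "c \<le> Re (hs_inner D W (marginal D N \<Phi>))"
      using assms(2) by blast
    let ?\<Psi> = "marginal_states D (Suc N) \<Phi>"
    have "hs_inner D W (one_body ?\<Psi>) = hs_inner D W (marginal D N \<Phi>)"
      by (rule hs_inner_cong[OF refl]) (rule one_body_marginal_states)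
    then have "?\<Psi> \<in> F M" if "M \<in> I" for M
      using marginal_states_in_ext_states[OF assms(1) \<Phi>(1)] \<Phi>(2) ext_states_antimono[OF N[OF that]]
      unfolding F_def by auto
    then show "bounded_kernels \<inter> (\<Inter>M\<in>I. F M) \<noteq> {}"
      using marginal_states_in_bounded_kernels[OF assms(1) \<Phi>(1)] by blast
  qed
  then show ?thesis using that unfolding F_def exch_states_def by blast
qed

lemma partial_trace_contract_last:
  assumes \<Phi>: "\<Phi> \<in> exch_states D \<K>" and xs: "xs \<in> words D N" and ys: "ys \<in> words D N"
  shows "partial_trace D (contract_last D J \<Phi>) xs ys = contract_last D J \<Phi> xs ys"
proof -
  have sym: "word_sym D (Suc (Suc N)) \<Phi>"
    using exch_statesD(2)[OF \<Phi>] by (simp add: ext_cone_def)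
  have swap: "\<Phi> (xs @ [c, a]) (ys @ [d, b]) = \<Phi> (xs @ [a, c]) (ys @ [b, d])"
    if "a \<in> D" "b \<in> D" "c \<in> D" "d \<in> D" for a b c d
    by (rule word_symD[OF sym]) (use that xs ys in \<open>simp_all add: words_def\<close>)
  have consistent: "hs_inner D id_kernel (\<lambda>c d. \<Phi> (xs @ [a, c]) (ys @ [b, d])) = \<Phi> (xs @ [a]) (ys @ [b])"
    if "a \<in> D" "b \<in> D" for a b
  proof -
    have "partial_trace D \<Phi> (xs @ [a]) (ys @ [b]) = \<Phi> (xs @ [a]) (ys @ [b])"
      by (rule exch_statesD(3)[OF \<Phi>, of _ "Suc N"]) (simp_all add: that xs ys)
    then show ?thesis by (simp add: contract_last_def)
  qed
  have "partial_trace D (contract_last D J \<Phi>) xs ys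
      = hs_inner D J (\<lambda>a b. hs_inner D id_kernel (\<lambda>c d. \<Phi> (xs @ [c, a]) (ys @ [d, b])))"
    unfolding contract_last_def append_assoc append_Cons append_Nil by (rule hs_inner_commute)
  also have "\<dots> = hs_inner D J (\<lambda>a b. \<Phi> (xs @ [a]) (ys @ [b]))"
  proof (rule hs_inner_cong[OF refl])
    fix a b assume "a \<in> D" "b \<in> D"
    have "hs_inner D id_kernel (\<lambda>c d. \<Phi> (xs @ [c, a]) (ys @ [d, b]))
        = hs_inner D id_kernel (\<lambda>c d. \<Phi> (xs @ [a, c]) (ys @ [b, d]))"
      by (rule hs_inner_cong[OF refl], rule swap) (use \<open>a \<in> D\<close> \<open>b \<in> D\<close> in simp_all)
    then show "hs_inner D id_kernel (\<lambda>c d. \<Phi> (xs @ [c, a]) (ys @ [d, b])) = \<Phi> (xs @ [a]) (ys @ [b])"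
      using consistent[OF \<open>a \<in> D\<close> \<open>b \<in> D\<close>] by simp
  qed
  finally show ?thesis by (simp add: contract_last_def)
qed

lemma contract_last_Nil: "contract_last D J \<Phi> [] [] = hs_inner D J (one_body \<Phi>)"
  by (simp add: contract_last_def one_body_def[abs_def])

lemma exch_states_hs_inner_nonneg:
  assumes "finite D" "\<Phi> \<in> exch_states D \<K>" "psd_on D J"
  shows "hs_inner D J (one_body \<Phi>) \<in> \<real>\<^sub>\<ge>\<^sub>0"
proof -
  have "psd_on (words D 0) (contract_last D J \<Phi>)"
    by (rule psd_on_contract_last[OF assms(1) _ assms(3)])
      (use exch_statesD(2)[OF assms(2)] in \<open>simp add: ext_cone_def\<close>)
  then show ?thesis
    using psd_on_diag[of "words D 0" "contract_last D J \<Phi>" "[]"] by (simp add: contract_last_Nil)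
qed

lemma exch_states_contract_last:
  assumes D: "finite D" and \<Phi>: "\<Phi> \<in> exch_states D \<K>" and J: "psd_on D J"
    and p: "p = hs_inner D J (one_body \<Phi>)" "p \<noteq> 0"
  shows "(\<lambda>xs ys. inverse p * contract_last D J \<Phi> xs ys) \<in> exch_states D \<K>" (is "?\<Psi> \<in> _")
  unfolding exch_states_iff
proof (intro conjI allI impI ballI)
  show "?\<Psi> [] [] = 1" using p by (simp add: contract_last_Nil)
next
  fix xs ys assume outside: "\<forall>N. xs \<notin> words D N \<or> ys \<notin> words D N"
  have "\<Phi> (xs @ [a]) (ys @ [b]) = 0" for a b
  proof -
    have "xs @ [a] \<notin> words D N \<or> ys @ [b] \<notin> words D N" for N
      using outside by (cases N) (auto simp: words_def)
    then show ?thesis using exch_statesD(4)[OF \<Phi>] by blast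
  qed
  then show "?\<Psi> xs ys = 0" by (simp add: contract_last_def hs_inner_def)
next
  fix N
  have "inverse p \<in> \<real>\<^sub>\<ge>\<^sub>0"
    using exch_states_hs_inner_nonneg[OF D \<Phi> J] p(1) by simp
  then show "ext_cone D \<K> N ?\<Psi>"
    by (intro ext_cone_scale ext_cone_contract_last D J exch_statesD(2)[OF \<Phi>])
next
  fix N xs ys assume "xs \<in> words D N" "ys \<in> words D N"
  then show "partial_trace D ?\<Psi> xs ys = ?\<Psi> xs ys"
    using partial_trace_contract_last[OF \<Phi>, of xs N ys J]
    unfolding contract_last_def[of D id_kernel] hs_inner_scale_right by simp
qed

lemma norm_contract_last_le:
  assumes "finite D" "\<Phi> \<in> exch_states D \<K>" "psd_on D J" "x \<in> D" "y \<in> D"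
  shows "cmod (contract_last D J \<Phi> [x] [y]) \<le> Re (hs_inner D J (one_body \<Phi>))"
proof -
  have "psd_on (words D (Suc 0)) (contract_last D J \<Phi>)"
    by (rule psd_on_contract_last[OF assms(1) _ assms(3)])
      (use exch_statesD(2)[OF assms(2)] in \<open>simp add: ext_cone_def\<close>)
  then have "cmod (contract_last D J \<Phi> [x] [y]) \<le> Re (\<Sum>a\<in>D. contract_last D J \<Phi> [a] [a])"
    using psd_on_norm_le_trace[OF psd_on_one_body[OF assms(1)] assms(1,4,5)] by (simp only: one_body_def)
  also have "(\<Sum>a\<in>D. contract_last D J \<Phi> [a] [a]) = partial_trace D (contract_last D J \<Phi>) [] []"
    unfolding contract_last_def[of D id_kernel] by (simp add: hs_inner_id_kernel[OF assms(1)])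
  also have "\<dots> = hs_inner D J (one_body \<Phi>)"
    using partial_trace_contract_last[OF assms(2), of "[]" 0 "[]"] by (simp add: contract_last_Nil)
  finally show ?thesis .
qed

lemma contract_last_add_complement:
  assumes "\<Phi> \<in> exch_states D \<K>" "xs \<in> words D N" "ys \<in> words D N"
  shows "contract_last D J \<Phi> xs ys + contract_last D (complement J) \<Phi> xs ys = \<Phi> xs ys"
proof -
  have "contract_last D J \<Phi> xs ys + contract_last D (complement J) \<Phi> xs ys = partial_trace D \<Phi> xs ys"
    by (simp add: contract_last_def hs_inner_diff_left)
  then show ?thesis using exch_statesD(3)[OF assms] by simp
qed

section \<open>Lexicographically maximal exchangeable states\<close>

lemma compact_attains_lex_sup:
  fixes f g :: "'b::topological_space \<Rightarrow> real"
  assumes "compact S" "S \<noteq> {}" "continuous_on UNIV f" "continuous_on UNIV g"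
  obtains x where "x \<in> S" "\<And>y. y \<in> S \<Longrightarrow> f y < f x \<or> f y = f x \<and> g y \<le> g x"
proof -
  obtain x\<^sub>0 where x\<^sub>0: "x\<^sub>0 \<in> S" "\<And>y. y \<in> S \<Longrightarrow> f y \<le> f x\<^sub>0"
    using continuous_attains_sup[OF assms(1,2) continuous_on_subset[OF assms(3) subset_UNIV]] by blast
  have "compact (S \<inter> {y. f y = f x\<^sub>0})"
    by (intro compact_Int_closed assms closed_Collect_eq continuous_on_const)
  then obtain x where "x \<in> S" "f x = f x\<^sub>0" "\<And>y. y \<in> S \<Longrightarrow> f y = f x\<^sub>0 \<Longrightarrow> g y \<le> g x"
    using continuous_attains_sup[OF _ _ continuous_on_subset[OF assms(4) subset_UNIV],
        of "S \<inter> {y. f y = f x\<^sub>0}"] x\<^sub>0(1)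
    by blast
  then show ?thesis using that x\<^sub>0(2) by (metis order_le_less)
qed

definition sq_norm_on :: "'a set \<Rightarrow> 'a kernel \<Rightarrow> real" where
  "sq_norm_on D f = (\<Sum>(x, y)\<in>D \<times> D. (cmod (f x y))\<^sup>2)"

lemma sq_norm_on_eq_0_imp:
  assumes "finite D" "sq_norm_on D f = 0" "x \<in> D" "y \<in> D"
  shows "f x y = 0"
  using assms by (auto simp: sq_norm_on_def case_prod_unfold sum_nonneg_eq_0_iff)

lemma sq_norm_on_convex_comb:
  assumes "p + q = 1"
  shows "sq_norm_on D (\<lambda>x y. p *\<^sub>R f x y + q *\<^sub>R g x y)
    = p * sq_norm_on D f + q * sq_norm_on D g - p * q * sq_norm_on D (\<lambda>x y. f x y - g x y)"
proof -
  have "(cmod (p *\<^sub>R z + q *\<^sub>R w))\<^sup>2 = p * (cmod z)\<^sup>2 + q * (cmod w)\<^sup>2 - p * q * (cmod (z - w))\<^sup>2" for z w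
  proof -
    have q: "q = 1 - p" using assms by simp
    show ?thesis unfolding cmod_power2 q by (simp add: power2_eq_square algebra_simps)
  qed
  then show ?thesis
    by (simp add: sq_norm_on_def case_prod_unfold sum.distrib sum_subtractf sum_distrib_left)
qed

definition lex_le :: "'a set \<Rightarrow> 'a kernel \<Rightarrow> 'a kernel \<Rightarrow> 'a kernel \<Rightarrow> bool" where
  "lex_le D W f g \<longleftrightarrow> Re (hs_inner D W f) < Re (hs_inner D W g) \<or>
     Re (hs_inner D W f) = Re (hs_inner D W g) \<and> sq_norm_on D f \<le> sq_norm_on D g"

definition lex_maximal :: "'a set \<Rightarrow> 'a kernel set \<Rightarrow> 'a kernel \<Rightarrow> 'a list kernel \<Rightarrow> bool" where
  "lex_maximal D \<K> W \<Phi> \<longleftrightarrow>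
     \<Phi> \<in> exch_states D \<K> \<and> (\<forall>\<Psi>\<in>exch_states D \<K>. lex_le D W (one_body \<Psi>) (one_body \<Phi>))"

lemma convex_comb_ge_imp_eq:
  fixes a b c p q :: real
  assumes "0 < p" "0 < q" "p + q = 1" "a \<le> c" "b \<le> c" "c \<le> p * a + q * b"
  shows "a = c" and "b = c"
proof -
  have "p * (c - a) + q * (c - b) = (p + q) * c - (p * a + q * b)"
    by (simp add: algebra_simps)
  also have "\<dots> \<le> 0" using assms(3,6) by simp
  finally have "p * (c - a) + q * (c - b) \<le> 0" .
  moreover have "0 \<le> p * (c - a)" "0 \<le> q * (c - b)" using assms by simp_all
  ultimately have "p * (c - a) = 0" "q * (c - b) = 0" by linarith+
  then show "a = c" and "b = c" using assms(1,2) by simp_all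
qed

lemma lex_le_convex_comb_eq:
  assumes "finite D" and pq: "0 < p" "0 < q" "p + q = 1"
    and h: "\<And>x y. x \<in> D \<Longrightarrow> y \<in> D \<Longrightarrow> h x y = p *\<^sub>R f x y + q *\<^sub>R g x y"
    and lex: "lex_le D W f h" "lex_le D W g h" and xy: "x \<in> D" "y \<in> D"
  shows "f x y = h x y"
proof -
  have "hs_inner D W h = hs_inner D W (\<lambda>x y. p *\<^sub>R f x y + q *\<^sub>R g x y)"
    by (rule hs_inner_cong) (simp_all add: h)
  then have "Re (hs_inner D W h) = p * Re (hs_inner D W f) + q * Re (hs_inner D W g)"
    by (simp add: hs_inner_add_right hs_inner_scale_right scaleR_conv_of_real)
  moreover have "Re (hs_inner D W f) \<le> Re (hs_inner D W h)" "Re (hs_inner D W g) \<le> Re (hs_inner D W h)"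
    using lex by (auto simp: lex_le_def)
  ultimately have "Re (hs_inner D W f) = Re (hs_inner D W h)" "Re (hs_inner D W g) = Re (hs_inner D W h)"
    using convex_comb_ge_imp_eq[OF pq] by simp_all
  then have sq_norm_le: "sq_norm_on D f \<le> sq_norm_on D h" "sq_norm_on D g \<le> sq_norm_on D h"
    using lex by (auto simp: lex_le_def)
  let ?spread = "p * q * sq_norm_on D (\<lambda>x y. f x y - g x y)"
  have "sq_norm_on D h = sq_norm_on D (\<lambda>x y. p *\<^sub>R f x y + q *\<^sub>R g x y)"
    unfolding sq_norm_on_def by (rule sum.cong) (auto simp: h)
  also have "\<dots> = p * sq_norm_on D f + q * sq_norm_on D g - ?spread"
    by (rule sq_norm_on_convex_comb[OF pq(3)])
  finally have sq_norm_h: "sq_norm_on D h = p * sq_norm_on D f + q * sq_norm_on D g - ?spread" .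
  moreover have "0 \<le> ?spread"
    using pq by (simp add: sq_norm_on_def case_prod_unfold sum_nonneg)
  ultimately have "sq_norm_on D f = sq_norm_on D h" "sq_norm_on D g = sq_norm_on D h"
    using convex_comb_ge_imp_eq[OF pq sq_norm_le] by simp_all
  with sq_norm_h have "?spread = (p + q - 1) * sq_norm_on D h"
    by (simp add: algebra_simps)
  then have "sq_norm_on D (\<lambda>x y. f x y - g x y) = 0"
    using pq by simp
  then have "g x y = f x y"
    using sq_norm_on_eq_0_imp[OF assms(1) _ xy, of "\<lambda>x y. f x y - g x y"] by simp
  then show ?thesis
    using h[OF xy] pq(3) by (simp add: scaleR_add_left[symmetric])
qed

lemma lex_maximal_contract_last:
  assumes D: "finite D" and maximal: "lex_maximal D \<K> W \<Phi>"
    and J: "psd_on D J" "psd_on D (complement J)" and xy: "x \<in> D" "y \<in> D"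
  shows "contract_last D J \<Phi> [x] [y] = hs_inner D J (one_body \<Phi>) * one_body \<Phi> x y"
proof -
  have \<Phi>: "\<Phi> \<in> exch_states D \<K>" using maximal by (simp add: lex_maximal_def)
  obtain p q where p: "hs_inner D J (one_body \<Phi>) = complex_of_real p" "0 \<le> p"
    and q: "hs_inner D (complement J) (one_body \<Phi>) = complex_of_real q" "0 \<le> q"
    using exch_states_hs_inner_nonneg[OF D \<Phi> J(1)] exch_states_hs_inner_nonneg[OF D \<Phi> J(2)]
    by (elim nonneg_Reals_cases)
  have "complex_of_real (p + q) = 1"
    using contract_last_add_complement[OF \<Phi>, of "[]" 0 "[]" J] exch_statesD(1)[OF \<Phi>] p q
    by (simp add: contract_last_Nil)
  then have pq: "p + q = 1" by (simp only: of_real_eq_1_iff)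
  have split: "contract_last D J \<Phi> [a] [b] + contract_last D (complement J) \<Phi> [a] [b] = one_body \<Phi> a b"
    if "a \<in> D" "b \<in> D" for a b
    using contract_last_add_complement[OF \<Phi>, of "[a]" 1 "[b]" J] that by (simp add: words_def one_body_def)
  consider (p_zero) "p = 0" | (q_zero) "q = 0" | (positive) "0 < p" "0 < q" using p(2) q(2) by linarith
  then show ?thesis
  proof cases
    case p_zero
    then show ?thesis using norm_contract_last_le[OF D \<Phi> J(1) xy] p by simp
  next
    case q_zero
    then show ?thesis using norm_contract_last_le[OF D \<Phi> J(2) xy] split[OF xy] p q pq by simp
  next
    case positive
    define f where "f = one_body (\<lambda>xs ys. inverse (complex_of_real p) * contract_last D J \<Phi> xs ys)"
    define g where "g = one_body (\<lambda>xs ys. inverse (complex_of_real q) * contract_last D (complement J) \<Phi> xs ys)"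
    have "lex_le D W f (one_body \<Phi>)" "lex_le D W g (one_body \<Phi>)"
      unfolding f_def g_def using maximal positive p q J
      by (auto simp: lex_maximal_def intro!: exch_states_contract_last[OF D \<Phi>])
    moreover have "one_body \<Phi> a b = p *\<^sub>R f a b + q *\<^sub>R g a b" if "a \<in> D" "b \<in> D" for a b
      using split[OF that] positive
      by (simp add: f_def g_def one_body_def scaleR_conv_of_real mult.assoc[symmetric])
    ultimately have "f x y = one_body \<Phi> x y"
      using lex_le_convex_comb_eq[OF D positive pq] xy by blast
    then show ?thesis using positive(1) p(1) by (auto simp: f_def one_body_def field_simps)
  qed
qed

lemma lex_maximal_product:
  assumes D: "finite D" and maximal: "lex_maximal D \<K> W \<Phi>"
    and xy: "x \<in> D" "y \<in> D" and ab: "a \<in> D" "b \<in> D"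
  shows "\<Phi> [x, a] [y, b] = one_body \<Phi> a b * one_body \<Phi> x y"
proof -
  define M where "M a b = \<Phi> [x, a] [y, b] - one_body \<Phi> x y * one_body \<Phi> a b" for a b
  have M: "hs_inner D J M = contract_last D J \<Phi> [x] [y] - one_body \<Phi> x y * hs_inner D J (one_body \<Phi>)"
    for J
    by (simp add: M_def[abs_def] hs_inner_diff_right hs_inner_scale_right contract_last_def)
  have "hs_inner D (outer_prod v) M = 0" for v
  proof -
    define s where "s = (\<Sum>x\<in>D. (cmod (v x))\<^sup>2)"
    define c where "c = 1 / (1 + s)"
    have s: "0 \<le> s" by (simp add: s_def sum_nonneg)
    then have "c \<noteq> 0" by (simp add: c_def)
    from s have "c\<^sup>2 * s \<le> 1"
      by (simp add: c_def power2_eq_square divide_le_eq) (simp add: algebra_simps)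
    then have "(\<Sum>x\<in>D. (cmod (c *\<^sub>R v x))\<^sup>2) \<le> 1"
      by (simp add: s_def power_mult_distrib sum_distrib_left)
    then have "hs_inner D (outer_prod (\<lambda>x. c *\<^sub>R v x)) M = 0"
      using lex_maximal_contract_last[OF D maximal psd_on_outer_prod psd_on_complement_outer_prod[OF D] xy]
      unfolding M by simp
    moreover have "outer_prod (\<lambda>x. c *\<^sub>R v x) = (\<lambda>x y. complex_of_real (c\<^sup>2) * outer_prod v x y)"
      by (simp add: fun_eq_iff outer_prod_def scaleR_conv_of_real power2_eq_square)
    ultimately show ?thesis
      using \<open>c \<noteq> 0\<close> by (simp add: hs_inner_scale_left)
  qed
  from hs_inner_outer_prod_eq_0_imp[OF D this ab] show ?thesis
    by (simp add: M_def mult.commute)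
qed

lemma psd_on_rank_one:
  assumes "finite D" "psd_on D \<rho>" "(\<Sum>x\<in>D. \<rho> x x) \<noteq> 0"
    and "\<And>a b x y. a \<in> D \<Longrightarrow> b \<in> D \<Longrightarrow> x \<in> D \<Longrightarrow> y \<in> D \<Longrightarrow> \<rho> a b * \<rho> x y = \<rho> x b * \<rho> a y"
  obtains \<psi> where "\<And>x y. x \<in> D \<Longrightarrow> y \<in> D \<Longrightarrow> \<rho> x y = outer_prod \<psi> x y"
proof -
  obtain l where l: "l \<in> D" "\<rho> l l \<noteq> 0" using assms(3) by (meson sum.neutral)
  have "\<rho> x y = (\<Sum>s\<in>{()}. \<rho> x l * (\<rho> l y / \<rho> l l))" if "x \<in> D" "y \<in> D" for x y
    using assms(4)[of x l l y] that l by (simp add: field_simps)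
  then show ?thesis
    using psd_on_gram[of "{()}" D \<rho> "\<lambda>_ x. \<rho> x l" "\<lambda>_ y. \<rho> l y / \<rho> l l"] assms(1,2) that by auto
qed

definition pure_feasible :: "'a set \<Rightarrow> 'a kernel set \<Rightarrow> ('a \<Rightarrow> complex) \<Rightarrow> bool" where
  "pure_feasible D \<K> \<psi> \<longleftrightarrow>
     hs_inner D id_kernel (outer_prod \<psi>) = 1 \<and> (\<forall>K\<in>\<K>. hs_inner D K (outer_prod \<psi>) = 0)"

lemma lex_maximal_pure:
  assumes D: "finite D" and maximal: "lex_maximal D \<K> W \<Phi>"
  obtains \<psi> where "pure_feasible D \<K> \<psi>" "\<And>J. hs_inner D J (one_body \<Phi>) = hs_inner D J (outer_prod \<psi>)"
proof -
  have \<Phi>: "\<Phi> \<in> exch_states D \<K>" using maximal by (simp add: lex_maximal_def)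
  have swap: "one_body \<Phi> a b * one_body \<Phi> x y = one_body \<Phi> x b * one_body \<Phi> a y"
    if "a \<in> D" "b \<in> D" "x \<in> D" "y \<in> D" for a b x y
  proof -
    have "word_sym D (Suc (Suc 0)) \<Phi>"
      using exch_statesD(2)[OF \<Phi>, of "Suc 0"] by (simp add: ext_cone_def)
    then have "\<Phi> [x, a] [y, b] = \<Phi> [a, x] [y, b]"
      by (rule word_symD) (simp_all add: that)
    then show ?thesis
      using lex_maximal_product[OF D maximal] that by simp
  qed
  have psd: "psd_on D (one_body \<Phi>)"
    by (rule psd_on_one_body[OF D]) (use exch_statesD(2)[OF \<Phi>, of 0] in \<open>simp add: ext_cone_def\<close>)
  have trace: "hs_inner D id_kernel (one_body \<Phi>) = 1"
    using exch_statesD(3)[OF \<Phi>, of "[]" 0 "[]"] exch_statesD(1)[OF \<Phi>] by (simp add: contract_last_Nil)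
  then have "(\<Sum>x\<in>D. one_body \<Phi> x x) \<noteq> 0"
    by (simp add: hs_inner_id_kernel[OF D])
  then obtain \<psi> where \<psi>: "\<And>x y. x \<in> D \<Longrightarrow> y \<in> D \<Longrightarrow> one_body \<Phi> x y = outer_prod \<psi> x y"
    using psd_on_rank_one[OF D psd _ swap] by blast
  have inner: "hs_inner D J (one_body \<Phi>) = hs_inner D J (outer_prod \<psi>)" for J
    by (rule hs_inner_cong[OF refl \<psi>])
  have "hs_inner D K (one_body \<Phi>) = 0" if "K \<in> \<K>" for K
    using ext_cone_orthogonal[OF exch_statesD(2)[OF \<Phi>] that, of "[]" 0 "[]"]
    by (simp add: one_body_def[abs_def])
  then have "pure_feasible D \<K> \<psi>"
    using trace by (simp add: pure_feasible_def inner)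
  then show ?thesis using that inner by blast
qed

lemma exch_states_le_pure:
  assumes "finite D" "\<Phi> \<in> exch_states D \<K>"
  obtains \<psi> where "pure_feasible D \<K> \<psi>"
    "Re (hs_inner D W (one_body \<Phi>)) \<le> Re (hs_inner D W (outer_prod \<psi>))"
proof -
  obtain \<Phi>' where \<Phi>': "lex_maximal D \<K> W \<Phi>'"
  proof (rule compact_attains_lex_sup)
    show "compact (exch_states D \<K>)" by (rule compact_exch_states[OF assms(1)])
    show "exch_states D \<K> \<noteq> {}" using assms(2) by blast
    show "continuous_on UNIV (\<lambda>\<Phi>. Re (hs_inner D W (one_body \<Phi>)))"
      unfolding one_body_def by (intro continuous_intros)
    show "continuous_on UNIV (\<lambda>\<Phi>. sq_norm_on D (one_body \<Phi>))"
      unfolding one_body_def sq_norm_on_def case_prod_unfold by (intro continuous_intros)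
  qed (use that in \<open>auto simp: lex_maximal_def lex_le_def\<close>)
  obtain \<psi> where \<psi>: "pure_feasible D \<K> \<psi>" "\<And>J. hs_inner D J (one_body \<Phi>') = hs_inner D J (outer_prod \<psi>)"
    using lex_maximal_pure[OF assms(1) \<Phi>'] by blast
  have "Re (hs_inner D W (one_body \<Phi>)) \<le> Re (hs_inner D W (one_body \<Phi>'))"
    using \<Phi>' assms(2) by (auto simp: lex_maximal_def lex_le_def)
  then show ?thesis using that[OF \<psi>(1)] \<psi>(2) by simp
qed

section \<open>Convergence of the hierarchy\<close>

definition tensor_power :: "('a \<Rightarrow> complex) \<Rightarrow> 'a list kernel" where
  "tensor_power \<psi> = outer_prod (\<lambda>xs. prod_list (map \<psi> xs))"

lemma funpow_partial_trace_tensor_power: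
  assumes "hs_inner D id_kernel (outer_prod \<psi>) = 1"
  shows "(partial_trace D ^^ N) (tensor_power \<psi>) = tensor_power \<psi>"
proof (induction N)
  case (Suc N)
  have "tensor_power \<psi> (xs @ [a]) (ys @ [b]) = tensor_power \<psi> xs ys * outer_prod \<psi> a b" for xs ys a b
    by (simp add: tensor_power_def outer_prod_def)
  then have "partial_trace D (tensor_power \<psi>) = tensor_power \<psi>"
    using assms by (simp add: fun_eq_iff contract_last_def hs_inner_scale_right)
  then show ?case using Suc.IH by simp
qed simp

lemma ext_feasible_tensor_power:
  assumes "pure_feasible D \<K> \<psi>"
  shows "ext_feasible D \<K> N (tensor_power \<psi>)"
proof -
  have "word_sym D (Suc N) (tensor_power \<psi>)"
    unfolding word_sym_def tensor_power_def outer_prod_def by (metis mset_map prod_mset_prod_list)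
  moreover have "hs_inner D K (\<lambda>x y. tensor_power \<psi> (x # xs) (y # ys)) = 0" if "K \<in> \<K>" for K xs ys
  proof -
    have "tensor_power \<psi> (x # xs) (y # ys) = tensor_power \<psi> xs ys * outer_prod \<psi> x y" for x y
      by (simp add: tensor_power_def outer_prod_def)
    then show ?thesis
      using assms that by (simp add: pure_feasible_def hs_inner_scale_right)
  qed
  moreover have "(partial_trace D ^^ Suc N) (tensor_power \<psi>) [] [] = 1"
    using funpow_partial_trace_tensor_power[of D \<psi> "Suc N"] assms
    by (simp add: pure_feasible_def tensor_power_def outer_prod_def del: funpow.simps)
  ultimately show ?thesis
    using psd_on_outer_prod unfolding ext_feasible_def ext_cone_def tensor_power_def by blast
qed

definition pure_opt :: "'a set \<Rightarrow> 'a kernel set \<Rightarrow> 'a kernel \<Rightarrow> ereal" where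
  "pure_opt D \<K> W = Sup {ereal (Re (hs_inner D W (outer_prod \<psi>))) | \<psi>. pure_feasible D \<K> \<psi>}"

definition ext_opt :: "'a set \<Rightarrow> 'a kernel set \<Rightarrow> 'a kernel \<Rightarrow> nat \<Rightarrow> ereal" where
  "ext_opt D \<K> W N =
     Sup {ereal (Re (hs_inner D W (marginal D N \<Phi>))) | \<Phi>. ext_feasible D \<K> N \<Phi>}"

lemma pure_opt_le_ext_opt: "pure_opt D \<K> W \<le> ext_opt D \<K> W N"
  unfolding pure_opt_def
proof (rule Sup_least, clarify)
  fix \<psi> assume \<psi>: "pure_feasible D \<K> \<psi>"
  then have "marginal D N (tensor_power \<psi>) = outer_prod \<psi>"
    using funpow_partial_trace_tensor_power[of D \<psi> N]
    by (simp add: pure_feasible_def fun_eq_iff one_body_def tensor_power_def outer_prod_def)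
  then show "ereal (Re (hs_inner D W (outer_prod \<psi>))) \<le> ext_opt D \<K> W N"
    unfolding ext_opt_def using ext_feasible_tensor_power[OF \<psi>, of N] by (intro Sup_upper) force
qed

lemma ext_opt_Suc_le:
  assumes "finite D"
  shows "ext_opt D \<K> W (Suc N) \<le> ext_opt D \<K> W N"
  unfolding ext_opt_def[of D \<K> W "Suc N"]
proof (rule Sup_least, clarify)
  fix \<Phi> assume "ext_feasible D \<K> (Suc N) \<Phi>"
  then have "ext_feasible D \<K> N (partial_trace D \<Phi>)"
    using ext_feasible_funpow_partial_trace[OF assms, of \<K> N 1] by simp
  then show "ereal (Re (hs_inner D W (marginal D (Suc N) \<Phi>))) \<le> ext_opt D \<K> W N"
    unfolding ext_opt_def by (intro Sup_upper) (auto simp: funpow_swap1)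
qed

lemma INF_ext_opt_le_pure_opt:
  assumes "finite D"
  shows "(INF N. ext_opt D \<K> W N) \<le> pure_opt D \<K> W"
proof (rule dense_le)
  fix z assume z: "z < (INF N. ext_opt D \<K> W N)"
  show "z \<le> pure_opt D \<K> W"
  proof (cases z)
    case (real c)
    have "\<exists>\<Phi>. ext_feasible D \<K> N \<Phi> \<and> c \<le> Re (hs_inner D W (marginal D N \<Phi>))" for N
    proof -
      have "ereal c < ext_opt D \<K> W N"
        using z real by (meson INF_lower UNIV_I less_le_trans)
      then show ?thesis unfolding ext_opt_def less_Sup_iff by (auto simp: less_imp_le)
    qed
    then obtain \<Phi> where \<Phi>: "\<Phi> \<in> exch_states D \<K>" "c \<le> Re (hs_inner D W (one_body \<Phi>))"
      using exch_states_value_ge[OF assms] by blast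
    obtain \<psi> where \<psi>: "pure_feasible D \<K> \<psi>"
      "Re (hs_inner D W (one_body \<Phi>)) \<le> Re (hs_inner D W (outer_prod \<psi>))"
      using exch_states_le_pure[OF assms \<Phi>(1)] by blast
    then have "ereal c \<le> ereal (Re (hs_inner D W (outer_prod \<psi>)))" using \<Phi>(2) by simp
    also have "\<dots> \<le> pure_opt D \<K> W"
      unfolding pure_opt_def using \<psi>(1) by (intro Sup_upper) blast
    finally show ?thesis unfolding real .
  qed (use z in auto)
qed

theorem ext_opt_tendsto_pure_opt:
  assumes "finite D"
  shows "ext_opt D \<K> W \<longlonglongrightarrow> pure_opt D \<K> W"
proof -
  have "(INF N. ext_opt D \<K> W N) = pure_opt D \<K> W"
    using INF_ext_opt_le_pure_opt[OF assms] by (intro antisym INF_greatest pure_opt_le_ext_opt)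
  moreover have "decseq (ext_opt D \<K> W)"
    by (intro decseq_SucI ext_opt_Suc_le assms)
  ultimately show ?thesis by (metis LIMSEQ_INF)
qed

section \<open>The symmetric projector as an average over permutations\<close>

definition perm_average :: "nat \<Rightarrow> ('a list \<Rightarrow> complex) \<Rightarrow> 'a list \<Rightarrow> complex" where
  "perm_average N g xs = (\<Sum>\<sigma> | \<sigma> permutes {..<N}. g (permute_list \<sigma> xs)) / fact N"

lemma perm_average_mset:
  assumes "mset xs' = mset xs" "length xs = N"
  shows "perm_average N g xs' = perm_average N g xs"
proof -
  obtain \<tau> where \<tau>: "\<tau> permutes {..<N}" "permute_list \<tau> xs = xs'"
    using mset_eq_permutation[OF assms(1)] assms(2) by metis
  have "(\<Sum>\<sigma> | \<sigma> permutes {..<N}. g (permute_list \<sigma> xs'))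
      = (\<Sum>\<sigma> | \<sigma> permutes {..<N}. g (permute_list (\<tau> \<circ> \<sigma>) xs))"
    using \<tau> assms(2) by (intro sum.cong) (simp_all add: permute_list_compose)
  also have "\<dots> = (\<Sum>\<sigma> | \<sigma> permutes {..<N}. g (permute_list \<sigma> xs))"
    by (rule setum_permutations_compose_left[OF \<tau>(1), symmetric])
  finally show ?thesis by (simp add: perm_average_def)
qed

lemma perm_average_invariant:
  assumes "\<And>ys. mset ys = mset xs \<Longrightarrow> g ys = g xs" "length xs = N"
  shows "perm_average N g xs = g xs"
proof -
  have "(\<Sum>\<sigma> | \<sigma> permutes {..<N}. g (permute_list \<sigma> xs)) = (\<Sum>\<sigma> | \<sigma> permutes {..<N}. g xs)"
    by (intro sum.cong refl assms(1)) (simp add: assms(2))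
  then show ?thesis by (simp add: perm_average_def card_permutations[OF refl])
qed

lemma eq_permute_list_iff:
  assumes "\<sigma> permutes {..<length ys}" "length xs = length ys"
  shows "xs = permute_list \<sigma> ys \<longleftrightarrow> ys = permute_list (inv_into UNIV \<sigma>) xs"
proof -
  have "permute_list (inv_into UNIV \<sigma>) (permute_list \<sigma> ys) = ys"
    using permute_list_compose[OF permutes_inv[OF assms(1)], of \<sigma>] permutes_inv_o[OF assms(1)] by simp
  moreover have "permute_list \<sigma> (permute_list (inv_into UNIV \<sigma>) xs) = xs"
    using permute_list_compose[of \<sigma> xs "inv_into UNIV \<sigma>"] permutes_inv_o[OF assms(1)] assms by simp
  ultimately show ?thesis by metis
qed

lemma permute_list_in_words:
  assumes "\<sigma> permutes {..<N}" "xs \<in> words D N"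
  shows "permute_list \<sigma> xs \<in> words D N"
  using words_mset[OF assms(2)] assms(1) length_words[OF assms(2)] by simp

lemma perm_op_eq_of_bool:
  assumes "\<sigma> permutes {..<N}" "length xs = N" "length ys = N"
  shows "perm_op N \<sigma> xs ys = of_bool (xs = permute_list \<sigma> ys)"
  using assms by (auto simp: perm_op_def list_eq_iff_nth_eq permute_list_nth)

lemma sum_mult_perm_op:
  assumes "finite D" "\<sigma> permutes {..<N}" "ys \<in> words D N"
  shows "(\<Sum>zs\<in>words D N. g zs * perm_op N \<sigma> zs ys) = g (permute_list \<sigma> ys)"
proof -
  have "(\<Sum>zs\<in>words D N. g zs * perm_op N \<sigma> zs ys)
      = (\<Sum>zs\<in>words D N. g zs * of_bool (zs = permute_list \<sigma> ys))"
    using assms by (intro sum.cong) (simp_all add: perm_op_eq_of_bool length_words)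
  then show ?thesis
    using assms permute_list_in_words[OF assms(2,3)] by simp
qed

lemma sum_perm_op_mult:
  assumes "finite D" "\<sigma> permutes {..<N}" "xs \<in> words D N"
  shows "(\<Sum>zs\<in>words D N. perm_op N \<sigma> xs zs * g zs) = g (permute_list (inv_into UNIV \<sigma>) xs)"
proof -
  have "(\<Sum>zs\<in>words D N. perm_op N \<sigma> xs zs * g zs)
      = (\<Sum>zs\<in>words D N. of_bool (zs = permute_list (inv_into UNIV \<sigma>) xs) * g zs)"
    using assms by (intro sum.cong) (simp_all add: perm_op_eq_of_bool eq_permute_list_iff length_words)
  then show ?thesis
    using assms permute_list_in_words[OF permutes_inv[OF assms(2)] assms(3)] by simp
qed

lemma sum_mult_sym_proj:
  assumes "finite D" "ys \<in> words D N"
  shows "(\<Sum>zs\<in>words D N. g zs * sym_proj N zs ys) = perm_average N g ys"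
proof -
  have "(\<Sum>zs\<in>words D N. g zs * sym_proj N zs ys)
      = (\<Sum>\<sigma> | \<sigma> permutes {..<N}. \<Sum>zs\<in>words D N. g zs * perm_op N \<sigma> zs ys) / fact N"
    by (subst sum.swap) (simp add: sym_proj_def sum_distrib_left sum_divide_distrib)
  then show ?thesis
    using assms by (simp add: sum_mult_perm_op perm_average_def)
qed

lemma sum_sym_proj_mult:
  assumes "finite D" "xs \<in> words D N"
  shows "(\<Sum>zs\<in>words D N. sym_proj N xs zs * g zs) = perm_average N g xs"
proof -
  have "(\<Sum>zs\<in>words D N. sym_proj N xs zs * g zs)
      = (\<Sum>\<sigma> | \<sigma> permutes {..<N}. \<Sum>zs\<in>words D N. perm_op N \<sigma> xs zs * g zs) / fact N"
    by (subst sum.swap) (simp add: sym_proj_def sum_distrib_right sum_divide_distrib)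
  also have "\<dots> = (\<Sum>\<sigma> | \<sigma> permutes {..<N}. g (permute_list (inv_into UNIV \<sigma>) xs)) / fact N"
    using assms by (simp add: sum_perm_op_mult)
  also have "\<dots> = perm_average N g xs"
    unfolding perm_average_def by (subst sum_permutations_inverse) (rule refl)
  finally show ?thesis .
qed

lemma perm_average_perm_average_word_sym:
  assumes sym: "word_sym D N \<Phi>" and W: "xs \<in> words D N" "ys \<in> words D N"
  shows "perm_average N (\<lambda>ys'. perm_average N (\<lambda>xs'. \<Phi> xs' ys') xs) ys = \<Phi> xs ys"
proof -
  have inner: "perm_average N (\<lambda>xs'. \<Phi> xs' ys') xs = \<Phi> xs ys" if "mset ys' = mset ys" for ys'
  proof -
    have "perm_average N (\<lambda>xs'. \<Phi> xs' ys') xs = \<Phi> xs ys'"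
      by (rule perm_average_invariant[OF _ length_words[OF W(1)]],
          rule word_symD[OF sym W(1) words_mset[OF W(2) that] _ refl])
    also have "\<dots> = \<Phi> xs ys"
      by (rule word_symD[OF sym W refl that])
    finally show ?thesis .
  qed
  have "perm_average N (\<lambda>ys'. perm_average N (\<lambda>xs'. \<Phi> xs' ys') xs) ys
      = perm_average N (\<lambda>xs'. \<Phi> xs' ys) xs"
    by (rule perm_average_invariant[OF _ length_words[OF W(2)]]) (simp add: inner)
  then show ?thesis by (simp add: inner)
qed

lemma word_sym_iff_perm_average:
  "word_sym D N \<Phi> \<longleftrightarrow> (\<forall>xs\<in>words D N. \<forall>ys\<in>words D N.
     perm_average N (\<lambda>ys'. perm_average N (\<lambda>xs'. \<Phi> xs' ys') xs) ys = \<Phi> xs ys)"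
  (is "_ \<longleftrightarrow> (\<forall>xs\<in>_. \<forall>ys\<in>_. ?avg xs ys = _)")
proof
  assume average: "\<forall>xs\<in>words D N. \<forall>ys\<in>words D N. ?avg xs ys = \<Phi> xs ys"
  show "word_sym D N \<Phi>"
    unfolding word_sym_def
  proof (intro ballI allI impI)
    fix xs ys xs' ys'
    assume W: "xs \<in> words D N" "ys \<in> words D N" and mset: "mset xs' = mset xs" "mset ys' = mset ys"
    have "\<Phi> xs' ys' = ?avg xs' ys'" "\<Phi> xs ys = ?avg xs ys"
      using average W words_mset[OF W(1) mset(1)] words_mset[OF W(2) mset(2)] by auto
    moreover have "?avg xs' ys' = ?avg xs ys"
      using perm_average_mset[OF mset(1) length_words[OF W(1)]]
        perm_average_mset[OF mset(2) length_words[OF W(2)]] by simp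
    ultimately show "\<Phi> xs' ys' = \<Phi> xs ys" by simp
  qed
qed (use perm_average_perm_average_word_sym in blast)

lemma party_idx_eq: "party_idx n k = {..<n} \<times> {..<k}"
  by (auto simp: party_idx_def)

lemma finite_party_idx [simp]: "finite (party_idx n k)"
  by (simp add: party_idx_eq)

lemma op_mult_sym_proj:
  assumes "xs \<in> words (party_idx n k) N" "ys \<in> words (party_idx n k) N"
  shows "op_mult n k N (op_mult n k N (sym_proj N) \<Phi>) (sym_proj N) xs ys
    = perm_average N (\<lambda>ys'. perm_average N (\<lambda>xs'. \<Phi> xs' ys') xs) ys"
  unfolding op_mult_def multi_idx_eq_words
    sum_sym_proj_mult[OF finite_party_idx assms(1)] sum_mult_sym_proj[OF finite_party_idx assms(2)] ..

lemma sym_proj_invariant_iff_word_sym: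
  "(\<forall>xs\<in>multi_idx n k N. \<forall>ys\<in>multi_idx n k N.
      op_mult n k N (op_mult n k N (sym_proj N) \<Phi>) (sym_proj N) xs ys = \<Phi> xs ys)
   \<longleftrightarrow> word_sym (party_idx n k) N \<Phi>"
  by (simp add: multi_idx_eq_words op_mult_sym_proj word_sym_iff_perm_average)

section \<open>The rank-constrained problem and its relaxations\<close>

definition tensor_id :: "nat kernel \<Rightarrow> (nat \<times> nat) kernel" where
  "tensor_id G x y = of_bool (snd x = snd y) * G (fst x) (fst y)"

definition mat_unit :: "nat \<Rightarrow> nat \<Rightarrow> nat \<Rightarrow> complex mat" where
  "mat_unit n i j = mat n n (\<lambda>(a, b). of_bool (a = i \<and> b = j))"

definition entry_kernel :: "nat \<Rightarrow> (complex mat \<Rightarrow> complex mat) \<Rightarrow> nat \<Rightarrow> nat \<Rightarrow> nat kernel" where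
  "entry_kernel n L p q i j = cnj (L (mat_unit n i j) $$ (p,q))"

lemma sum_party_idx: "(\<Sum>x\<in>party_idx n k. f x) = (\<Sum>i<n. \<Sum>a<k. f (i, a))"
  by (simp add: party_idx_eq sum.cartesian_product)

lemma ptrace_2_carrier [simp]: "ptrace_2 n k M \<in> carrier_mat n n"
  by (simp add: ptrace_2_def)

lemma hs_inner_tensor_id:
  "hs_inner (party_idx n k) (tensor_id G) M = hs_inner {..<n} G (entries (ptrace_2 n k M))"
proof -
  have "hs_inner (party_idx n k) (tensor_id G) M
      = (\<Sum>i<n. \<Sum>a<k. \<Sum>j<n. \<Sum>b<k. of_bool (a = b) * (cnj (G i j) * M (i, a) (j, b)))"
    by (simp add: hs_inner_def sum.cartesian_product[symmetric] sum_party_idx tensor_id_def mult.assoc)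
  also have "\<dots> = (\<Sum>i<n. \<Sum>a<k. \<Sum>j<n. cnj (G i j) * M (i, a) (j, a))"
    by (intro sum.cong refl) simp
  also have "\<dots> = (\<Sum>i<n. \<Sum>j<n. \<Sum>a<k. cnj (G i j) * M (i, a) (j, a))"
    by (rule sum.cong[OF refl], rule sum.swap)
  finally show ?thesis
    by (simp add: hs_inner_def sum.cartesian_product[symmetric] ptrace_2_def sum_distrib_left)
qed

lemma linear_map_mat_entry:
  assumes L: "linear_map_mat n m L" and A: "A \<in> carrier_mat n n" and pq: "p < m" "q < m"
  shows "L A $$ (p,q) = hs_inner {..<n} (entry_kernel n L p q) (entries A)"
proof -
  have carrier: "L B \<in> carrier_mat m m" if "B \<in> carrier_mat n n" for B
    using L that by (simp add: linear_map_mat_def)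
  have unit: "mat_unit n i j \<in> carrier_mat n n" for i j by (simp add: mat_unit_def)
  define part where "part S = mat n n (\<lambda>(i,j). if (i,j) \<in> S then A $$ (i,j) else 0)" for S
  have part: "part S \<in> carrier_mat n n" for S by (simp add: part_def)
  have "L (part S) $$ (p,q) = (\<Sum>(i,j)\<in>S. L (mat_unit n i j) $$ (p,q) * A $$ (i,j))" if "finite S" for S
    using that
  proof (induction S rule: finite_induct)
    case empty
    have "part {} = 0 \<cdot>\<^sub>m part {}" by (rule eq_matI) (auto simp: part_def)
    then have "L (part {}) = 0 \<cdot>\<^sub>m L (part {})"
      using L part unfolding linear_map_mat_def by metis
    then have "L (part {}) $$ (p,q) = (0 \<cdot>\<^sub>m L (part {})) $$ (p,q)" by (rule arg_cong)
    then show ?case using carrier[OF part, of "{}"] pq by simp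
  next
    case (insert x S)
    obtain i j where x: "x = (i, j)" by force
    have "part (insert x S) = part S + A $$ (i,j) \<cdot>\<^sub>m mat_unit n i j"
      by (rule eq_matI) (use insert.hyps x in \<open>auto simp: part_def mat_unit_def\<close>)
    then have "L (part (insert x S)) = L (part S) + A $$ (i,j) \<cdot>\<^sub>m L (mat_unit n i j)"
      using L part unit by (simp add: linear_map_mat_def)
    then show ?case
      using carrier[OF part, of S] carrier[OF unit, of i j] pq insert by (simp add: x add.commute)
  qed
  moreover have "part ({..<n} \<times> {..<n}) = A"
    by (rule eq_matI) (use A in \<open>auto simp: part_def\<close>)
  ultimately have "L A $$ (p,q) = (\<Sum>(i,j)\<in>{..<n} \<times> {..<n}. L (mat_unit n i j) $$ (p,q) * A $$ (i,j))"
    using finite_cartesian_product[of "{..<n}" "{..<n}"] by fastforce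
  then show ?thesis by (simp add: hs_inner_def entry_kernel_def)
qed

text \<open>Represents the (p, q) entry of Lambda~(M) - Tr(M) Y as a linear functional of M.\<close>

definition constr_kernel ::
    "nat \<Rightarrow> (complex mat \<Rightarrow> complex mat) \<Rightarrow> complex mat \<Rightarrow> nat \<Rightarrow> nat \<Rightarrow> (nat \<times> nat) kernel" where
  "constr_kernel n L Y p q x y = tensor_id (entry_kernel n L p q) x y - cnj (Y $$ (p,q)) * id_kernel x y"

definition constr_kernels ::
    "nat \<Rightarrow> nat \<Rightarrow> (complex mat \<Rightarrow> complex mat) \<Rightarrow> complex mat \<Rightarrow> (nat \<times> nat) kernel set" where
  "constr_kernels n m L Y = (\<lambda>(p, q). constr_kernel n L Y p q) ` ({..<m} \<times> {..<m})"

lemma constr_kernels_orthogonal_iff: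
  assumes L: "linear_map_mat n m L"
  shows "(\<forall>K\<in>constr_kernels n m L Y. hs_inner (party_idx n k) K M = 0)
    \<longleftrightarrow> (\<forall>p<m. \<forall>q<m. L (ptrace_2 n k M) $$ (p,q) = Y $$ (p,q) * (\<Sum>x\<in>party_idx n k. M x x))"
proof -
  have "hs_inner (party_idx n k) (constr_kernel n L Y p q) M
      = L (ptrace_2 n k M) $$ (p,q) - Y $$ (p,q) * (\<Sum>x\<in>party_idx n k. M x x)"
    if "p < m" "q < m" for p q
    using linear_map_mat_entry[OF L ptrace_2_carrier that]
    by (simp add: constr_kernel_def[abs_def] hs_inner_diff_left hs_inner_scale_left hs_inner_tensor_id
        hs_inner_id_kernel)
  then show ?thesis unfolding constr_kernels_def by auto
qed

lemma op_psd_iff_psd_on: "op_psd n k N \<Phi> \<longleftrightarrow> psd_on (multi_idx n k N) \<Phi>"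
  by (simp add: op_psd_def psd_on_def hs_inner_outer_prod_eq_sum nonneg_Reals_iff_Reals Let_def)

lemma feasible_N_iff:
  assumes "linear_map_mat n m L"
  shows "feasible_N n m k (Suc N) L Y \<Phi> \<longleftrightarrow> ext_feasible (party_idx n k) (constr_kernels n m L Y) N \<Phi>"
proof -
  let ?D = "party_idx n k"
  have "(\<forall>p<m. \<forall>q<m. \<forall>xs\<in>words ?D N. \<forall>ys\<in>words ?D N.
        lift_map n k L \<Phi> p xs q ys = Y $$ (p,q) * ptrace_A n k \<Phi> xs ys)
     \<longleftrightarrow> (\<forall>K\<in>constr_kernels n m L Y. \<forall>xs\<in>words ?D N. \<forall>ys\<in>words ?D N.
        hs_inner ?D K (\<lambda>x y. \<Phi> (x # xs) (y # ys)) = 0)"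
    using constr_kernels_orthogonal_iff[OF assms, of Y k "\<lambda>x y. \<Phi> (x # _) (y # _)"]
    unfolding lift_map_def ptrace_A_def by blast
  then show ?thesis
    unfolding feasible_N_def sym_proj_invariant_iff_word_sym
    unfolding ext_feasible_def ext_cone_def op_psd_iff_psd_on op_trace_def multi_idx_eq_words
      funpow_partial_trace[OF finite_party_idx] append_Nil diff_Suc_1 by blast
qed

lemma mtrace_mult_hermitian:
  assumes "hermitian_mat n X" "A \<in> carrier_mat n n"
  shows "mtrace (X * A) = hs_inner {..<n} (entries X) (entries A)"
proof -
  have X: "X \<in> carrier_mat n n" "\<And>i j. i < n \<Longrightarrow> j < n \<Longrightarrow> X $$ (j,i) = cnj (X $$ (i,j))"
    using assms(1) unfolding hermitian_mat_def by blast+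
  have "mtrace (X * A) = (\<Sum>j<n. \<Sum>i<n. X $$ (j,i) * A $$ (i,j))"
    using X(1) assms(2) by (simp add: mtrace_def scalar_prod_def atLeast0LessThan)
  also have "\<dots> = (\<Sum>i<n. \<Sum>j<n. cnj (X $$ (i,j)) * A $$ (i,j))"
    by (subst sum.swap) (intro sum.cong refl, simp add: X(2)[symmetric])
  finally show ?thesis by (simp add: hs_inner_def sum.cartesian_product)
qed

lemma obj_N_eq:
  assumes "hermitian_mat n X"
  shows "obj_N n k (Suc N) X \<Phi>
    = hs_inner (party_idx n k) (tensor_id (entries X)) (marginal (party_idx n k) N \<Phi>)"
proof -
  let ?block = "\<lambda>xs x y. \<Phi> (x # xs) (y # xs)"
  have "X \<in> carrier_mat n n"
    using assms by (simp only: hermitian_mat_def)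
  then have "(\<Sum>i<n. \<Sum>j<n. \<Sum>a<k. X $$ (i,j) * ?block xs (j, a) (i, a))
      = mtrace (X * ptrace_2 n k (?block xs))" for xs
    by (simp add: mtrace_def scalar_prod_def atLeast0LessThan ptrace_2_def sum_distrib_left)
  then have "obj_N n k (Suc N) X \<Phi> = (\<Sum>xs\<in>words (party_idx n k) N. mtrace (X * ptrace_2 n k (?block xs)))"
    by (simp add: obj_N_def multi_idx_eq_words)
  also have "\<dots> = hs_inner (party_idx n k) (tensor_id (entries X))
      (\<lambda>x y. \<Sum>xs\<in>words (party_idx n k) N. ?block xs x y)"
    by (simp add: mtrace_mult_hermitian[OF assms] hs_inner_tensor_id hs_inner_sum_right)
  finally show ?thesis
    by (simp add: one_body_def[abs_def] funpow_partial_trace)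
qed

lemma xi_N_eq_ext_opt:
  assumes "hermitian_mat n X" "linear_map_mat n m L"
  shows "xi_N n m k X L Y (Suc N)
    = ext_opt (party_idx n k) (constr_kernels n m L Y) (tensor_id (entries X)) N"
  unfolding xi_N_def ext_opt_def obj_N_eq[OF assms(1)] feasible_N_iff[OF assms(2)] ..

lemma psd_rank_le_iff_purification:
  "psd_mat n \<rho> \<and> mat_rank n \<rho> \<le> k \<longleftrightarrow> (\<exists>\<psi>. \<rho> = ptrace_2 n k (outer_prod \<psi>))"
proof (intro iffI conjI; (elim conjE exE)?)
  assume \<rho>: "psd_mat n \<rho>" "mat_rank n \<rho> \<le> k"
  obtain b where "\<And>i j. i < n \<Longrightarrow> j < n \<Longrightarrow> \<rho> $$ (i,j) = (\<Sum>s<k. outer_prod (b s) i j)"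
    using psd_mat_rank_gram[OF \<rho>] by blast
  then have "\<rho> = ptrace_2 n k (outer_prod (\<lambda>(i, a). b a i))"
    using \<rho>(1) by (intro eq_matI) (auto simp: psd_mat_def ptrace_2_def outer_prod_def)
  then show "\<exists>\<psi>. \<rho> = ptrace_2 n k (outer_prod \<psi>)" by blast
next
  fix \<psi> assume \<rho>: "\<rho> = ptrace_2 n k (outer_prod \<psi>)"
  have "psd_on {..<n} (\<lambda>i j. \<Sum>a<k. outer_prod (\<lambda>i. \<psi> (i, a)) i j)"
    by (rule psd_on_sum, rule psd_on_outer_prod)
  also have "?this \<longleftrightarrow> psd_on {..<n} (entries \<rho>)"
    by (rule psd_on_cong) (simp add: \<rho> ptrace_2_def outer_prod_def)
  finally show "psd_mat n \<rho>"
    by (simp add: psd_mat_iff_psd_on \<rho>)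
  show "mat_rank n \<rho> \<le> k"
    using mat_rank_sum_le_card[of "{..<k}" n n "\<lambda>a i. \<psi> (i, a)" "\<lambda>a j. cnj (\<psi> (j, a))"]
    by (simp add: \<rho> ptrace_2_def outer_prod_def)
qed

lemma xi_opt_eq_pure_opt:
  assumes X: "hermitian_mat n X" and L: "linear_map_mat n m L" and Y: "Y \<in> carrier_mat m m"
  shows "xi_opt n m k X L Y
    = pure_opt (party_idx n k) (constr_kernels n m L Y) (tensor_id (entries X))"
proof -
  let ?R = "\<lambda>\<psi>. ptrace_2 n k (outer_prod \<psi>)"
  let ?feasible = "pure_feasible (party_idx n k) (constr_kernels n m L Y)"
  have feasible: "L (?R \<psi>) = Y \<and> mtrace (?R \<psi>) = 1 \<longleftrightarrow> ?feasible \<psi>" for \<psi>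
  proof -
    have "L (?R \<psi>) \<in> carrier_mat m m"
      using L by (simp add: linear_map_mat_def)
    then have "L (?R \<psi>) = Y \<longleftrightarrow> (\<forall>p<m. \<forall>q<m. L (?R \<psi>) $$ (p,q) = Y $$ (p,q))"
      using Y by (auto intro!: eq_matI)
    moreover have "mtrace (?R \<psi>) = (\<Sum>x\<in>party_idx n k. outer_prod \<psi> x x)"
      by (simp add: mtrace_def ptrace_2_def sum_party_idx)
    ultimately show ?thesis
      unfolding pure_feasible_def constr_kernels_orthogonal_iff[OF L]
        hs_inner_id_kernel[OF finite_party_idx] by auto
  qed
  have objective: "mtrace (X * ?R \<psi>) = hs_inner (party_idx n k) (tensor_id (entries X)) (outer_prod \<psi>)"
    for \<psi>
    by (simp add: mtrace_mult_hermitian[OF X] hs_inner_tensor_id)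
  have "\<rho> \<in> carrier_mat n n \<and> L \<rho> = Y \<and> mtrace \<rho> = 1 \<and> psd_mat n \<rho> \<and> mat_rank n \<rho> \<le> k
      \<longleftrightarrow> (\<exists>\<psi>. \<rho> = ?R \<psi> \<and> ?feasible \<psi>)" for \<rho>
    using psd_rank_le_iff_purification[of n \<rho> k] feasible by (metis psd_mat_def)
  then have "{ereal (Re (mtrace (X * \<rho>))) | \<rho>.
        \<rho> \<in> carrier_mat n n \<and> L \<rho> = Y \<and> mtrace \<rho> = 1 \<and> psd_mat n \<rho> \<and> mat_rank n \<rho> \<le> k}
      = {ereal (Re (mtrace (X * ?R \<psi>))) | \<psi>. ?feasible \<psi>}"
    by (simp only:) blast
  then show ?thesis
    unfolding xi_opt_def pure_opt_def objective by simp
qed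

theorem theorem2:
  fixes n m k :: nat and X Y :: "complex mat" and L :: "complex mat \<Rightarrow> complex mat"
  assumes "0 < n" "0 < m" "0 < k"
    and "hermitian_mat n X"
    and "linear_map_mat n m L"
    and "Y \<in> carrier_mat m m"
  shows "(\<forall>N\<ge>1. xi_opt n m k X L Y \<le> xi_N n m k X L Y N)
       \<and> (\<forall>N\<ge>1. xi_N n m k X L Y (N + 1) \<le> xi_N n m k X L Y N)
       \<and> (xi_N n m k X L Y \<longlonglongrightarrow> xi_opt n m k X L Y)"
proof -
  note opts = xi_N_eq_ext_opt[OF assms(4,5)] xi_opt_eq_pure_opt[OF assms(4-6)]
  show ?thesis
  proof (intro conjI allI impI)
    fix N :: nat assume "N \<ge> 1"
    then obtain M where N: "N = Suc M" by (cases N) auto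
    show "xi_opt n m k X L Y \<le> xi_N n m k X L Y N"
      unfolding N opts by (rule pure_opt_le_ext_opt)
    show "xi_N n m k X L Y (N + 1) \<le> xi_N n m k X L Y N"
      unfolding N Suc_eq_plus1[symmetric] opts by (rule ext_opt_Suc_le[OF finite_party_idx])
  next
    have "(\<lambda>N. xi_N n m k X L Y (Suc N)) \<longlonglongrightarrow> xi_opt n m k X L Y"
      unfolding opts by (rule ext_opt_tendsto_pure_opt[OF finite_party_idx])
    then show "xi_N n m k X L Y \<longlonglongrightarrow> xi_opt n m k X L Y" by (rule LIMSEQ_imp_Suc)
  qed
qed

end
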